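(* Assume the setting described in the context, with bounded measurable drifts $b_+,b_-$, and suppose there are constants $r_+>0$, $r_->0$ such that for all $x\in\mathbb R$ $$b_+(x)\ge r_+,\qquad b_-(x)\ge -r_-,\qquad\text{and}\qquad \frac{r_+}{\lambda_+}>\frac{r_-}{\lambda_-}.$$ Then $X_t\to+\infty$ almost surely as $t\to\infty$. Moreover, there is a constant $c_0>0$ such that $$\liminf_{t\to\infty}\frac{X_t}{t}\ge c_0\quad\text{a.s.},$$ and there is a constant $c_0>0$ such that for every $\epsilon>0$ there exist $\kappa\in(0,1)$ and $t_0=t_0(\kappa,\epsilon)$ with $$\mathbb P_x\Big(\frac{X_t-x}{t}-c_0<-\epsilon\Big)<\kappa^{t}\qquad\text{for all } t\ge t_0 .$$
   Context: Let $(\Omega,\mathcal F,(\mathcal F_t),\mathbb P)$ be a filtered probability space carrying a one-dimensional standard Wiener process $W$ and, independent of $W$, a continuous-time Markov chain $Z=(Z_t)_{t\ge0}$ with right-continuous paths taking values in $\{0,1\}$; $\mathcal F_t$ is generated by $W$ and $Z$ up to time $t$. State $1$ is the "$+$" regime and state $0$ the "$-$" regime: the chain leaves state $1$ with constant rate $\lambda_+>0$ and leaves state $0$ with constant rate $\lambda_->0$ (so sojourn times are independent exponential variables with these parameters). Let $b_+,b_-:\mathbb R\to\mathbb R$ be Borel measurable with $\sup_x|b_\pm(x)|<\infty$, and set $b(x,1)=b_+(x)$, $b(x,0)=b_-(x)$. The process $X$ is the unique strong solution of $$dX_t=b(X_t,Z_t)\,dt+dW_t,\qquad X_0=x\in\mathbb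 R,\ Z_0=z\in\{0,1\};$$ $\mathbb P_x,\mathbb E_x$ denote probability and expectation for this process started at $X_0=x$. *)

theory Defs
  imports "HOL-Probability.Probability"
begin

definition wiener_process :: "'a measure \<Rightarrow> (real \<Rightarrow> 'a \<Rightarrow> real) \<Rightarrow> bool" where
  "wiener_process M W \<longleftrightarrow>
     prob_space M \<and>
     (\<forall>t. W t \<in> borel_measurable M) \<and>
     (AE \<omega> in M. W 0 \<omega> = 0 \<and> continuous_on {0..} (\<lambda>t. W t \<omega>)) \<and>
     (\<forall>s t. 0 \<le> s \<and> s < t \<longrightarrow>
        distributed M lborel (\<lambda>\<omega>. W t \<omega> - W s \<omega>) (normal_density 0 (sqrt (t - s)))) \<and>
     (\<forall>(ts :: nat \<Rightarrow> real) n. 0 \<le> ts 0 \<and> (\<forall>i<n. ts i < ts (Suc i)) \<longrightarrow>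
        prob_space.indep_vars M (\<lambda>_. borel) (\<lambda>i \<omega>. W (ts (Suc i)) \<omega> - W (ts i) \<omega>) {..<n})"

text \<open>Transition probabilities P(Z_{s+t} = j | Z_s = i) of the two-state chain on {0,1}
  which leaves state 1 with rate lp and state 0 with rate lm (generator
  Q = [[-lm, lm],[lp, -lp]] in the order (0,1)); this is exp(tQ).\<close>
definition two_state_trans :: "real \<Rightarrow> real \<Rightarrow> real \<Rightarrow> nat \<Rightarrow> nat \<Rightarrow> real" where
  "two_state_trans lp lm t i j =
     (let q = lp + lm; e = exp (- q * t) in
      if i = 1 \<and> j = 1 then lm / q + lp / q * e
      else if i = 1 \<and> j = 0 then lp / q * (1 - e)
      else if i = 0 \<and> j = 0 then lp / q + lm / q * e
      else if i = 0 \<and> j = 1 then lm / q * (1 - e)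
      else 0)"

definition two_state_chain ::
  "'a measure \<Rightarrow> real \<Rightarrow> real \<Rightarrow> nat \<Rightarrow> (real \<Rightarrow> 'a \<Rightarrow> nat) \<Rightarrow> bool" where
  "two_state_chain M lp lm z Z \<longleftrightarrow>
     prob_space M \<and>
     (\<forall>t. Z t \<in> measurable M (count_space UNIV)) \<and>
     (AE \<omega> in M. \<forall>t\<ge>0. Z t \<omega> \<in> {0, 1} \<and> ((\<lambda>s. Z s \<omega>) \<longlongrightarrow> Z t \<omega>) (at_right t)) \<and>
     (\<forall>(ts :: nat \<Rightarrow> real) (js :: nat \<Rightarrow> nat) n.
        ts 0 = 0 \<and> (\<forall>i<n. ts i < ts (Suc i)) \<longrightarrow>
        measure M {\<omega> \<in> space M. \<forall>k\<le>n. Z (ts k) \<omega> = js k} =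
          (if js 0 = z then 1 else 0) *
          (\<Prod>k<n. two_state_trans lp lm (ts (Suc k) - ts k) (js k) (js (Suc k))))"

definition WZ_filtration ::
  "'a measure \<Rightarrow> (real \<Rightarrow> 'a \<Rightarrow> real) \<Rightarrow> (real \<Rightarrow> 'a \<Rightarrow> nat) \<Rightarrow> real \<Rightarrow> 'a measure" where
  "WZ_filtration M W Z t = sigma (space M)
     ({W s -` A \<inter> space M | s A. 0 \<le> s \<and> s \<le> t \<and> A \<in> sets borel} \<union>
      {Z s -` A \<inter> space M | s A. 0 \<le> s \<and> s \<le> t} \<union> null_sets M)"

definition indep_processes ::
  "'a measure \<Rightarrow> (real \<Rightarrow> 'a \<Rightarrow> real) \<Rightarrow> (real \<Rightarrow> 'a \<Rightarrow> nat) \<Rightarrow> bool" where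
  "indep_processes M W Z \<longleftrightarrow>
     prob_space.indep_set M
       (sigma_sets (space M) {W t -` A \<inter> space M | t A. 0 \<le> t \<and> A \<in> sets borel})
       (sigma_sets (space M) {Z t -` A \<inter> space M | t A. 0 \<le> t})"

definition switched_drift :: "(real \<Rightarrow> real) \<Rightarrow> (real \<Rightarrow> real) \<Rightarrow> real \<Rightarrow> nat \<Rightarrow> real" where
  "switched_drift bp bm y k = (if k = 1 then bp y else bm y)"

definition strong_solution ::
  "'a measure \<Rightarrow> (real \<Rightarrow> real) \<Rightarrow> (real \<Rightarrow> real) \<Rightarrow> real \<Rightarrow>
   (real \<Rightarrow> 'a \<Rightarrow> real) \<Rightarrow> (real \<Rightarrow> 'a \<Rightarrow> nat) \<Rightarrow> (real \<Rightarrow> 'a \<Rightarrow> real) \<Rightarrow> bool" where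
  "strong_solution M bp bm x W Z X \<longleftrightarrow>
     (\<forall>t\<ge>0. X t \<in> borel_measurable (WZ_filtration M W Z t)) \<and>
     (AE \<omega> in M. continuous_on {0..} (\<lambda>t. X t \<omega>) \<and>
        (\<forall>t\<ge>0. X t \<omega> = x + (LINT s:{0..t}|lborel. switched_drift bp bm (X s \<omega>) (Z s \<omega>)) + W t \<omega>))"

end

theory Submission
  imports Defs
begin

text \<open>Write \<open>X t - x = J t + W t\<close>, where \<open>J\<close> is the accumulated drift. It dominates the additive
  functional \<open>\<integral> f (Z s) ds\<close> of the chain with \<open>f 1 = rp\<close> and \<open>f 0 = - rm\<close>, whose stationary mean
  \<open>c\<close> is positive. Perturbing the constant function by a multiple of the solution of the
  Poisson equation gives a positive function on which the tilted generator \<open>Q - \<theta> f\<close> acts with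
  rate at most \<open>- \<theta> c + O(\<theta>\<^sup>2)\<close>; through Riemann sums over a fine time grid and Fatou's lemma this
  bounds \<open>E exp (- \<theta> J t)\<close>. Chernoff's inequality for \<open>J t\<close> and for \<open>W t\<close> separately then yields
  the exponential tail bound. Borel-Cantelli turns it into linear growth along integer times;
  between integers, \<open>J\<close> decreases by at most \<open>rm\<close>, and dyadic chaining with fourth moments shows
  that \<open>W\<close> fluctuates by \<open>O(sqrt n)\<close> on \<open>[n, n + 1]\<close>.\<close>

section \<open>The two-state chain observed on a time grid\<close>

lemma two_state_trans_nonneg:
  assumes "lp > 0" "lm > 0" "t \<ge> 0"
  shows "two_state_trans lp lm t i j \<ge> 0"
  using assms by (auto simp: two_state_trans_def Let_def)

text \<open>A discrete Feynman-Kac bound: by \<open>step\<close>, one step of the kernel weighted by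
  \<open>a\<close> multiplies \<open>\<phi>\<close> by at most \<open>\<Lambda>\<close>. Since the
  chain is given by its finite-dimensional distributions, conditioning on the past is replaced by
  restriction to cylinder events.\<close>

lemma nn_integral_chain_product_le:
  fixes a \<phi> :: "nat \<Rightarrow> ennreal"
  assumes chain: "two_state_chain M lp lm z Z" and pos: "lp > 0" "lm > 0" "h > 0"
    and z: "z \<in> {0, 1}"
    and step: "\<And>i. i \<in> {0, 1} \<Longrightarrow>
      (\<Sum>j\<in>{0, 1}. ennreal (two_state_trans lp lm h i j) * a j * \<phi> j) \<le> \<Lambda> * \<phi> i"
  shows "(\<integral>\<^sup>+\<omega>. (\<Prod>k<n. a (Z (real (Suc k) * h) \<omega>)) * \<phi> (Z (real n * h) \<omega>) \<partial>M) \<le> \<Lambda> ^ n * \<phi> z"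
proof -
  interpret prob_space M using chain by (simp add: two_state_chain_def)
  have Zm [measurable]: "Z t \<in> measurable M (count_space UNIV)" for t
    using chain by (simp add: two_state_chain_def)
  have am [measurable]: "g \<in> measurable (count_space UNIV) borel" for g :: "nat \<Rightarrow> ennreal"
    by simp
  have states: "AE \<omega> in M. \<forall>t\<ge>0. Z t \<omega> \<in> {0, 1}"
    using chain unfolding two_state_chain_def by (auto elim: eventually_mono)
  \<comment> \<open>\<open>A m js\<close> fixes the first \<open>m + 1\<close> grid states;
    \<open>G m\<close> keeps only the weights of the steps that lie after grid point
    \<open>m\<close>.\<close>
  define A where "A m js = {\<omega> \<in> space M. \<forall>k\<le>m. Z (real k * h) \<omega> = js k}" for m js
  define G where "G m \<omega> = (\<Prod>k\<in>{m..<n}. a (Z (real (Suc k) * h) \<omega>)) * \<phi> (Z (real n * h) \<omega>)" for m \<omega>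
  have A_sets [measurable]: "A m js \<in> sets M" for m js unfolding A_def by measurable
  have G_meas [measurable]: "G m \<in> borel_measurable M" for m unfolding G_def by measurable
  have prob_A: "measure M (A m js) = (if js 0 = z then 1 else 0) *
      (\<Prod>k<m. two_state_trans lp lm h (js k) (js (Suc k)))" for m js
  proof -
    have "measure M (A m js) = (if js 0 = z then 1 else 0) *
      (\<Prod>k<m. two_state_trans lp lm (real (Suc k) * h - real k * h) (js k) (js (Suc k)))"
      using chain pos unfolding two_state_chain_def A_def
      by (auto simp del: of_nat_Suc simp: spec[of _ "\<lambda>k. real k * h"])
    then show ?thesis by (simp add: algebra_simps)
  qed
  have A_Suc: "emeasure M (A (Suc m) (js(Suc m := j))) =
      emeasure M (A m js) * ennreal (two_state_trans lp lm h (js m) j)" for m js j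
  proof -
    have "measure M (A (Suc m) (js(Suc m := j))) =
      measure M (A m js) * two_state_trans lp lm h (js m) j"
      unfolding prob_A by simp
    then show ?thesis
      by (simp add: emeasure_eq_measure ennreal_mult two_state_trans_nonneg pos less_imp_le)
  qed
  \<comment> \<open>Backward induction on \<open>m\<close>: on a cylinder event, each of the
    remaining \<open>n - m\<close> steps costs one factor \<open>\<Lambda>\<close>.\<close>
  have main: "\<forall>js. js m \<in> {0, 1} \<longrightarrow>
      (\<integral>\<^sup>+\<omega>. G m \<omega> * indicator (A m js) \<omega> \<partial>M) \<le> emeasure M (A m js) * (\<Lambda> ^ (n - m) * \<phi> (js m))"
    if "m \<le> n" for m
    using that
  proof (induction rule: inc_induct)
    case base
    have "(\<integral>\<^sup>+\<omega>. G n \<omega> * indicator (A n js) \<omega> \<partial>M) = (\<integral>\<^sup>+\<omega>. \<phi> (js n) * indicator (A n js) \<omega> \<partial>M)" for js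
      by (intro nn_integral_cong) (auto simp: G_def A_def indicator_def)
    then show ?case by (simp add: nn_integral_cmult_indicator mult.commute)
  next
    case (step m)
    show ?case
    proof (intro allI impI)
      fix js :: "nat \<Rightarrow> nat" assume js: "js m \<in> {0, 1}"
      \<comment> \<open>The event \<open>A m js\<close> is split according to the next state
        \<open>j\<close>; \<open>A_Suc\<close> turns the masses of the pieces into transition
        probabilities.\<close>
      let ?js = "\<lambda>j. js(Suc m := j)"
      have split_G: "G m \<omega> = a (Z (real (Suc m) * h) \<omega>) * G (Suc m) \<omega>" for \<omega>
        using step.hyps by (simp add: G_def prod.atLeast_Suc_lessThan mult.assoc)
      have A_iff: "\<omega> \<in> A (Suc m) (?js j) \<longleftrightarrow> \<omega> \<in> A m js \<and> Z (real (Suc m) * h) \<omega> = j" for \<omega> j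
        unfolding A_def by (auto simp: le_Suc_eq)
      have "(\<integral>\<^sup>+\<omega>. G m \<omega> * indicator (A m js) \<omega> \<partial>M) =
        (\<integral>\<^sup>+\<omega>. (\<Sum>j\<in>{0, 1}. a j * (G (Suc m) \<omega> * indicator (A (Suc m) (?js j)) \<omega>)) \<partial>M)"
      proof (intro nn_integral_cong_AE, use states in eventually_elim)
        fix \<omega> assume "\<forall>t\<ge>0. Z t \<omega> \<in> {0, 1}"
        then have "Z (real (Suc m) * h) \<omega> \<in> {0, 1}" using pos by (simp del: of_nat_Suc)
        then show "G m \<omega> * indicator (A m js) \<omega> =
          (\<Sum>j\<in>{0, 1}. a j * (G (Suc m) \<omega> * indicator (A (Suc m) (?js j)) \<omega>))"
          unfolding split_G by (auto simp: indicator_def A_iff simp del: of_nat_Suc)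
      qed
      also have "\<dots> = (\<Sum>j\<in>{0, 1}. a j * (\<integral>\<^sup>+\<omega>. G (Suc m) \<omega> * indicator (A (Suc m) (?js j)) \<omega> \<partial>M))"
        by (simp add: nn_integral_add nn_integral_cmult)
      also have "\<dots> \<le> (\<Sum>j\<in>{0, 1}. a j * (emeasure M (A (Suc m) (?js j)) * (\<Lambda> ^ (n - Suc m) * \<phi> j)))"
      proof (intro sum_mono mult_left_mono)
        fix j :: nat assume "j \<in> {0, 1}"
        then show "(\<integral>\<^sup>+\<omega>. G (Suc m) \<omega> * indicator (A (Suc m) (?js j)) \<omega> \<partial>M)
            \<le> emeasure M (A (Suc m) (?js j)) * (\<Lambda> ^ (n - Suc m) * \<phi> j)"
          using step.IH[rule_format, of "?js j"] by simp
      qed simp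
      also have "\<dots> = emeasure M (A m js) * \<Lambda> ^ (n - Suc m) *
          (\<Sum>j\<in>{0, 1}. ennreal (two_state_trans lp lm h (js m) j) * a j * \<phi> j)"
        unfolding A_Suc by (simp add: algebra_simps)
      also have "\<dots> \<le> emeasure M (A m js) * \<Lambda> ^ (n - Suc m) * (\<Lambda> * \<phi> (js m))"
        by (intro mult_left_mono assms(6) js) simp
      also have "\<Lambda> ^ (n - m) = \<Lambda> * \<Lambda> ^ (n - Suc m)"
        using step.hyps by (metis Suc_diff_Suc power_Suc)
      then have "emeasure M (A m js) * \<Lambda> ^ (n - Suc m) * (\<Lambda> * \<phi> (js m)) =
          emeasure M (A m js) * (\<Lambda> ^ (n - m) * \<phi> (js m))"
        by (simp add: mult_ac)
      finally show "(\<integral>\<^sup>+\<omega>. G m \<omega> * indicator (A m js) \<omega> \<partial>M)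
          \<le> emeasure M (A m js) * (\<Lambda> ^ (n - m) * \<phi> (js m))" .
    qed
  qed
  \<comment> \<open>The chain starts at \<open>z\<close> almost surely, so the case
    \<open>m = 0\<close> involves no actual restriction.\<close>
  have prob0: "prob (A 0 (\<lambda>_. z)) = 1" by (simp add: prob_A)
  have "AE \<omega> in M. \<omega> \<in> A 0 (\<lambda>_. z)"
    using prob0 by (simp add: prob_eq_1)
  then have "(\<integral>\<^sup>+\<omega>. G 0 \<omega> \<partial>M) = (\<integral>\<^sup>+\<omega>. G 0 \<omega> * indicator (A 0 (\<lambda>_. z)) \<omega> \<partial>M)"
    by (intro nn_integral_cong_AE) (auto elim!: eventually_mono)
  also have "\<dots> \<le> \<Lambda> ^ n * \<phi> z"
    using main[of 0, rule_format, of "\<lambda>_. z"] z prob0 by (simp add: emeasure_eq_measure)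
  finally show ?thesis by (simp add: G_def atLeast0LessThan)
qed

text \<open>With \<open>Q\<close> the generator of the chain, \<open>\<phi> = 1 + \<theta> g\<close> where \<open>g = (D, 0)\<close> solves
  \<open>Q g = f - c\<close>. Hence \<open>(Q - \<theta> f) \<phi> = - \<theta> c - \<theta>\<^sup>2 f g\<close>, which is at most
  \<open>- \<theta> (c - \<theta> (c + rm) D) \<phi>\<close>, and this is the derivative at \<open>h = 0\<close> of the left-hand side.\<close>
lemma two_state_generator_bound:
  fixes lp lm rp rm \<theta> \<mu> :: real
  defines "D \<equiv> (rp + rm) / (lp + lm)" and "c \<equiv> (rp * lm - rm * lp) / (lp + lm)"
  defines "\<phi> \<equiv> \<lambda>i::nat. if i = 1 then 1 else 1 + \<theta> * D"
    and "f \<equiv> \<lambda>i::nat. if i = 1 then rp else - rm"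
  assumes pos: "lp > 0" "lm > 0" "rp > 0" "rm > 0" "c > 0" and \<theta>: "\<theta> > 0"
    and \<mu>: "- \<theta> * (c - \<theta> * ((c + rm) * D)) < \<mu>" and i: "i \<in> {0, 1::nat}"
  shows "eventually (\<lambda>h. (\<Sum>j\<in>{0, 1}. two_state_trans lp lm h i j * exp (- \<theta> * h * f j) * \<phi> j)
            \<le> exp (\<mu> * h) * \<phi> i) (at_right 0)"
proof -
  define q where "q = lp + lm"
  define F where "F h = exp (\<mu> * h) * \<phi> i -
     (\<Sum>j\<in>{0, 1}. two_state_trans lp lm h i j * exp (- \<theta> * h * f j) * \<phi> j)" for h
  \<comment> \<open>\<open>L\<close> is the value of \<open>(Q - \<theta> f) \<phi>\<close> at
    \<open>i\<close>, the derivative at \<open>h = 0\<close> of the sum inside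
    \<open>F\<close>.\<close>
  define L where "L = (if i = 1 then - \<theta> * rp + lp * \<theta> * D
     else (\<theta> * rm) * (1 + \<theta> * D) - lm * \<theta> * D)"
  have q: "q > 0" using pos by (simp add: q_def)
  have D: "D > 0" using pos by (simp add: D_def)
  have qD: "q * D = rp + rm" using q by (simp add: D_def q_def)
  have qc: "q * c = rp * lm - rm * lp" using q by (simp add: c_def q_def)
  have F0: "F 0 = 0"
    using i q by (auto simp: F_def two_state_trans_def \<phi>_def q_def Let_def add_divide_distrib[symmetric] add.commute)
  \<comment> \<open>The stationary weights of the states 0 and 1.\<close>
  define \<alpha> \<beta> where "\<alpha> = lp / q" and "\<beta> = lm / q"
  have eqs: "\<alpha> * q = lp" "\<beta> * q = lm" "\<beta> + \<alpha> = 1" "\<alpha> + \<beta> = 1"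
    using q by (auto simp: \<alpha>_def \<beta>_def q_def add_divide_distrib[symmetric])
  have "(F has_real_derivative (\<mu> * \<phi> i - L)) (at 0)"
  proof (cases "i = 1")
    case True
    have "F = (\<lambda>h. exp (\<mu> * h) - (\<alpha> * (1 - exp (- q * h)) * exp (\<theta> * h * rm) * (1 + \<theta> * D)
       + (\<beta> + \<alpha> * exp (- q * h)) * exp (- \<theta> * h * rp)))"
      using True by (auto simp: fun_eq_iff F_def two_state_trans_def \<phi>_def f_def q_def[symmetric] \<alpha>_def \<beta>_def Let_def)
    moreover have "((\<lambda>h. exp (\<mu> * h) - (\<alpha> * (1 - exp (- q * h)) * exp (\<theta> * h * rm) * (1 + \<theta> * D)
       + (\<beta> + \<alpha> * exp (- q * h)) * exp (- \<theta> * h * rp)))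
       has_real_derivative (\<mu> - (\<alpha> * q * (1 + \<theta> * D) + (- (\<alpha> * q) - (\<beta> + \<alpha>) * \<theta> * rp)))) (at 0)"
      by (auto intro!: derivative_eq_intros simp: algebra_simps)
    moreover have "\<mu> - (\<alpha> * q * (1 + \<theta> * D) + (- (\<alpha> * q) - (\<beta> + \<alpha>) * \<theta> * rp)) = \<mu> * \<phi> i - L"
      using True by (simp only: eqs) (simp add: L_def \<phi>_def algebra_simps)
    ultimately show ?thesis by simp
  next
    case False
    then have i0: "i = 0" using i by simp
    have "F = (\<lambda>h. exp (\<mu> * h) * (1 + \<theta> * D) - ((\<alpha> + \<beta> * exp (- q * h)) * exp (\<theta> * h * rm) * (1 + \<theta> * D)
       + \<beta> * (1 - exp (- q * h)) * exp (- \<theta> * h * rp)))"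
      using i0 by (auto simp: fun_eq_iff F_def two_state_trans_def \<phi>_def f_def q_def[symmetric] \<alpha>_def \<beta>_def Let_def)
    moreover have "((\<lambda>h. exp (\<mu> * h) * (1 + \<theta> * D) - ((\<alpha> + \<beta> * exp (- q * h)) * exp (\<theta> * h * rm) * (1 + \<theta> * D)
       + \<beta> * (1 - exp (- q * h)) * exp (- \<theta> * h * rp)))
       has_real_derivative (\<mu> * (1 + \<theta> * D) - ((- (\<beta> * q) + (\<alpha> + \<beta>) * \<theta> * rm) * (1 + \<theta> * D) + \<beta> * q))) (at 0)"
      by (auto intro!: derivative_eq_intros simp: algebra_simps)
    moreover have "\<mu> * (1 + \<theta> * D) - ((- (\<beta> * q) + (\<alpha> + \<beta>) * \<theta> * rm) * (1 + \<theta> * D) + \<beta> * q) = \<mu> * \<phi> i - L"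
      using i0 by (simp only: eqs) (simp add: L_def \<phi>_def algebra_simps)
    ultimately show ?thesis by simp
  qed
  moreover have "\<mu> * \<phi> i - L > 0"
  proof (cases "i = 1")
    case True
    \<comment> \<open>The row of the Poisson equation for state 1; \<open>lmD\<close> below is the
      row for state 0.\<close>
    have "lp * D = rp - c"
    proof -
      have "q * (lp * D) = lp * (q * D)" by simp
      also have "\<dots> = q * rp - q * c" unfolding qD qc by (simp add: algebra_simps q_def)
      finally have "q * (lp * D) = q * (rp - c)" by (simp add: algebra_simps)
      then show ?thesis using q by simp
    qed
    moreover have "L = - \<theta> * (rp - lp * D)" using True by (simp add: L_def algebra_simps)
    ultimately have "L = - \<theta> * c" by simp
    moreover have "- \<theta> * c < \<mu>"
    proof -
      have "0 \<le> \<theta> * (\<theta> * ((c + rm) * D))" using \<theta> D pos by simp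
      then show ?thesis using \<mu> by (simp add: algebra_simps)
    qed
    ultimately show ?thesis using True by (simp add: \<phi>_def)
  next
    case False
    have lmD: "lm * D = rm + c"
    proof -
      have "q * (lm * D) = lm * (q * D)" by simp
      also have "\<dots> = q * rm + q * c" unfolding qD qc by (simp add: algebra_simps q_def)
      finally have "q * (lm * D) = q * (rm + c)" by (simp add: algebra_simps)
      then show ?thesis using q by simp
    qed
    have "L = - \<theta> * c + \<theta> * \<theta> * rm * D"
    proof -
      have "L = \<theta> * rm + \<theta> * \<theta> * rm * D - \<theta> * (lm * D)" using False by (simp add: L_def algebra_simps)
      then show ?thesis unfolding lmD by (simp add: algebra_simps)
    qed
    also have "\<dots> = - \<theta> * c * (1 + \<theta> * D) + \<theta> * \<theta> * ((c + rm) * D)" by (simp add: algebra_simps)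
    \<comment> \<open>The nonnegative second-order term is enlarged by the factor
      \<open>1 + \<theta> * D\<close>, so that the whole bound becomes a multiple of
      \<open>\<phi> 0\<close>.\<close>
    also have "\<dots> \<le> - \<theta> * c * (1 + \<theta> * D) + \<theta> * \<theta> * ((c + rm) * D) * (1 + \<theta> * D)"
      using \<theta> D pos by simp
    also have "\<dots> = (- \<theta> * (c - \<theta> * ((c + rm) * D))) * (1 + \<theta> * D)" by (simp add: algebra_simps)
    also have "\<dots> < \<mu> * (1 + \<theta> * D)"
      using \<mu> \<theta> D by (intro mult_strict_right_mono) (auto simp: add_pos_pos)
    finally show ?thesis using False by (simp add: \<phi>_def)
  qed
  \<comment> \<open>\<open>F\<close> vanishes at 0 and has a positive derivative there, hence it is
    positive just to the right of 0.\<close>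
  ultimately obtain d where d: "d > 0" "\<And>h. 0 < h \<Longrightarrow> h < d \<Longrightarrow> F 0 < F (0 + h)"
    using DERIV_pos_inc_right by blast
  have "eventually (\<lambda>h. 0 < F h) (at_right 0)"
    unfolding eventually_at_right_field using d F0 by auto
  then show ?thesis by eventually_elim (simp add: F_def)
qed

section \<open>Moments and path fluctuations of the Wiener process\<close>

text \<open>Every grid point of level \<open>j + 1\<close> is a grid point of level \<open>j\<close>
  or the right neighbour of one, so refining by one level costs at most one increment. The costs
  form a geometric series, and continuity carries the bound from dyadic points to all of
  \<open>[0, 1]\<close>.\<close>

lemma dyadic_chaining:
  fixes w :: "real \<Rightarrow> real"
  assumes cont: "continuous_on {0..1} w" and r: "0 \<le> r" "r < 1" and "A \<ge> 0"
    and incr: "\<And>j k. k < 2 ^ j \<Longrightarrow> \<bar>w (real (Suc k) / 2 ^ j) - w (real k / 2 ^ j)\<bar> \<le> A * r ^ j"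
    and s: "s \<in> {0..1}"
  shows "\<bar>w s - w 0\<bar> \<le> A / (1 - r)"
proof -
  have grid: "\<bar>w (real k / 2 ^ j) - w 0\<bar> \<le> A * (\<Sum>i\<le>j. r ^ i)" if "k \<le> 2 ^ j" for j k :: nat
    using that
  proof (induction j arbitrary: k)
    case 0
    then have "k = 0 \<or> k = 1" by auto
    then show ?case using incr[of 0 0] \<open>A \<ge> 0\<close> by auto
  next
    case (Suc j)
    \<comment> \<open>\<open>m / 2 ^ j\<close> is the nearest grid point of level \<open>j\<close>
      at or to the left of \<open>k / 2 ^ Suc j\<close>.\<close>
    define m where "m = k div 2"
    have m: "m \<le> 2 ^ j" using Suc.prems by (auto simp: m_def)
    have half: "real (2 * m) / 2 ^ Suc j = real m / 2 ^ j" by simp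
    have IH: "\<bar>w (real (2 * m) / 2 ^ Suc j) - w 0\<bar> \<le> A * (\<Sum>i\<le>j. r ^ i)"
      using Suc.IH[OF m] unfolding half .
    have "\<bar>w (real k / 2 ^ Suc j) - w (real (2 * m) / 2 ^ Suc j)\<bar> \<le> A * r ^ Suc j"
    proof (cases "even k")
      case True
      then have "k = 2 * m" by (simp add: m_def)
      then show ?thesis using \<open>A \<ge> 0\<close> r by simp
    next
      case False
      then have "k = Suc (2 * m)" by (auto simp: m_def)
      then show ?thesis using incr[of "2 * m" "Suc j"] Suc.prems by (simp del: of_nat_Suc of_nat_mult power_Suc)
    qed
    with IH have "\<bar>w (real k / 2 ^ Suc j) - w 0\<bar> \<le> A * (\<Sum>i\<le>j. r ^ i) + A * r ^ Suc j" by linarith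
    then show ?case by (simp add: algebra_simps)
  qed
  have bound: "A * (\<Sum>i\<le>j. r ^ i) \<le> A / (1 - r)" for j
  proof -
    have "(\<Sum>i\<le>j. r ^ i) \<le> (\<Sum>i. r ^ i)"
      using r by (intro sum_le_suminf) auto
    also have "\<dots> = 1 / (1 - r)" using r by (simp add: suminf_geometric)
    finally have "A * (\<Sum>i\<le>j. r ^ i) \<le> A * (1 / (1 - r))" using \<open>A \<ge> 0\<close> by (rule mult_left_mono)
    then show ?thesis by simp
  qed
  \<comment> \<open>The largest dyadic point of level \<open>j\<close> not exceeding
    \<open>s\<close>.\<close>
  define d where "d j = real (nat \<lfloor>s * 2 ^ j\<rfloor>) / 2 ^ j" for j :: nat
  have fl: "real (nat \<lfloor>s * 2 ^ j\<rfloor>) = of_int \<lfloor>s * 2 ^ j\<rfloor>" for j using s by simp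
  have d_le: "d j \<le> s" for j
    unfolding d_def fl by (simp add: divide_le_eq)
  have d_ge: "s - (1/2) ^ j \<le> d j" for j
  proof -
    have "s * 2 ^ j - 1 \<le> of_int \<lfloor>s * 2 ^ j\<rfloor>" by linarith
    then have "(s * 2 ^ j - 1) / 2 ^ j \<le> d j" unfolding d_def fl by (intro divide_right_mono) auto
    then show ?thesis by (simp add: diff_divide_distrib power_one_over)
  qed
  have "(\<lambda>j. s - (1/2::real) ^ j) \<longlonglongrightarrow> s - 0"
    by (intro tendsto_intros) auto
  then have d_lim: "d \<longlonglongrightarrow> s"
    by (intro tendsto_sandwich[of "\<lambda>j. s - (1/2) ^ j" d sequentially "\<lambda>_. s"]) (auto simp: d_le d_ge)
  have d_in: "d j \<in> {0..1}" for j
  proof -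
    have "0 \<le> d j" by (simp add: d_def)
    moreover have "d j \<le> 1" using d_le[of j] s by simp
    ultimately show ?thesis by simp
  qed
  have "(\<lambda>j. w (d j)) \<longlonglongrightarrow> w s"
    using continuous_on_tendsto_compose[OF cont d_lim s] d_in by simp
  then have lim: "(\<lambda>j. \<bar>w (d j) - w 0\<bar>) \<longlonglongrightarrow> \<bar>w s - w 0\<bar>" by (intro tendsto_intros)
  have "\<bar>w (d j) - w 0\<bar> \<le> A / (1 - r)" for j
  proof -
    have "s * 2 ^ j \<le> 2 ^ j" using s by simp
    then have "\<lfloor>s * 2 ^ j\<rfloor> \<le> 2 ^ j" by (metis floor_mono floor_numeral_power)
    then have "nat \<lfloor>s * 2 ^ j\<rfloor> \<le> 2 ^ j" by (simp add: nat_le_iff)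
    from order.trans[OF grid[OF this] bound] show ?thesis by (simp add: d_def)
  qed
  then show ?thesis by (intro LIMSEQ_le_const2[OF lim]) blast
qed

text \<open>The quadratic order in \<open>t - s\<close> is what chaining needs: the
  \<open>2 ^ j\<close> increments of length \<open>1 / 2 ^ j\<close> contribute a total of order
  \<open>1 / 2 ^ j\<close>.\<close>

lemma wiener_increment_fourth_moment:
  assumes "wiener_process M W" "0 \<le> s" "s < t"
  shows "(\<integral>\<^sup>+\<omega>. ennreal ((W t \<omega> - W s \<omega>) ^ 4) \<partial>M) = ennreal (3 * (t - s)\<^sup>2)"
proof -
  have \<sigma>: "0 < sqrt (t - s)" using assms by simp
  have "distributed M lborel (\<lambda>\<omega>. W t \<omega> - W s \<omega>) (normal_density 0 (sqrt (t - s)))"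
    using assms unfolding wiener_process_def by blast
  then have "(\<integral>\<^sup>+\<omega>. ennreal ((W t \<omega> - W s \<omega>) ^ 4) \<partial>M) =
      (\<integral>\<^sup>+x. ennreal (normal_density 0 (sqrt (t - s)) x) * ennreal (x ^ 4) \<partial>lborel)"
    by (subst distributed_nn_integral) auto
  also have "\<dots> = (\<integral>\<^sup>+x. ennreal (normal_density 0 (sqrt (t - s)) x * (x - 0) ^ (2 * 2)) \<partial>lborel)"
    by (intro nn_integral_cong) (auto simp: ennreal_mult)
  also have "\<dots> = ennreal (\<integral>x. normal_density 0 (sqrt (t - s)) x * (x - 0) ^ (2 * 2) \<partial>lborel)"
    using normal_moment_even[OF \<sigma>, of 0 2]
    by (intro nn_integral_eq_integral) (auto simp: has_bochner_integral_iff)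
  also have "\<dots> = ennreal (3 * (t - s)\<^sup>2)"
  proof -
    have "fact (2 * 2) / ((2 / (sqrt (t - s))\<^sup>2)\<^sup>2 * fact 2) = 3 * (t - s)\<^sup>2"
      using assms by (simp add: fact_numeral power_divide)
    then show ?thesis unfolding integral_normal_moment_even[OF \<sigma>] by simp
  qed
  finally show ?thesis .
qed

text \<open>Completing the square turns the exponentially tilted Gaussian density into a multiple of
  the density with mean \<open>- \<theta> * t\<close>.\<close>

lemma wiener_exponential_moment:
  assumes "wiener_process M W" "0 < t"
  shows "(\<integral>\<^sup>+\<omega>. ennreal (exp (- \<theta> * W t \<omega>)) \<partial>M) = ennreal (exp (\<theta>\<^sup>2 * t / 2))"
proof -
  define \<sigma> where "\<sigma> = sqrt (t - 0)"
  have \<sigma>: "0 < \<sigma>" "\<sigma>\<^sup>2 = t" using assms by (auto simp: \<sigma>_def)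
  have dist: "distributed M lborel (\<lambda>\<omega>. W t \<omega> - W 0 \<omega>) (normal_density 0 \<sigma>)"
    using assms unfolding wiener_process_def \<sigma>_def by blast
  have shift: "normal_density 0 \<sigma> y * exp (- \<theta> * y) = exp (\<theta>\<^sup>2 * t / 2) * normal_density (- \<theta> * t) \<sigma> y" for y
  proof -
    have "- y\<^sup>2 / (2 * t) + - \<theta> * y = \<theta>\<^sup>2 * t / 2 + - (y - - \<theta> * t)\<^sup>2 / (2 * t)"
      using assms by (simp add: field_simps power2_eq_square)
    then have "exp (- y\<^sup>2 / (2 * t)) * exp (- \<theta> * y) =
        exp (\<theta>\<^sup>2 * t / 2) * exp (- (y - - \<theta> * t)\<^sup>2 / (2 * t))"
      by (simp only: exp_add[symmetric])
    then show ?thesis by (simp add: normal_density_def \<sigma>)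
  qed
  have "AE \<omega> in M. W 0 \<omega> = 0"
    using assms unfolding wiener_process_def by (auto elim: eventually_mono)
  then have "(\<integral>\<^sup>+\<omega>. ennreal (exp (- \<theta> * W t \<omega>)) \<partial>M) = (\<integral>\<^sup>+\<omega>. ennreal (exp (- \<theta> * (W t \<omega> - W 0 \<omega>))) \<partial>M)"
    by (intro nn_integral_cong_AE) (auto elim!: eventually_mono)
  also have "\<dots> = (\<integral>\<^sup>+y. ennreal (normal_density 0 \<sigma> y) * ennreal (exp (- \<theta> * y)) \<partial>lborel)"
    by (subst distributed_nn_integral[OF dist]) auto
  also have "\<dots> = (\<integral>\<^sup>+y. ennreal (exp (\<theta>\<^sup>2 * t / 2)) * ennreal (normal_density (- \<theta> * t) \<sigma> y) \<partial>lborel)"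
    by (simp only: ennreal_mult[symmetric] shift normal_density_nonneg exp_ge_zero)
  also have "\<dots> = ennreal (exp (\<theta>\<^sup>2 * t / 2))"
    using \<sigma> by (simp add: nn_integral_cmult nn_integral_eq_integral)
  finally show ?thesis .
qed

text \<open>The fourth powers of all dyadic increments, weighted by \<open>r\<^sup>-\<^sup>4\<^sup>j (n + 1)\<^sup>-\<^sup>2\<close> with
  \<open>1 / 2 < r\<^sup>4 < 1\<close>, have a finite expected sum, so almost surely all increments are
  controlled simultaneously.\<close>
lemma wiener_unit_interval_fluctuation:
  assumes W: "wiener_process M W"
  shows "AE \<omega> in M. \<exists>S\<ge>0. \<forall>n::nat. \<forall>s\<in>{0..1}. \<bar>W (real n + s) \<omega> - W (real n) \<omega>\<bar> \<le> S * sqrt (real (Suc n))"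
proof -
  interpret prob_space M using W by (simp add: wiener_process_def)
  have [measurable]: "W t \<in> borel_measurable M" for t using W by (simp add: wiener_process_def)
  define r :: real where "r = 9 / 10"
  define D where "D n j k \<omega> = W (real n + real (Suc k) / 2 ^ j) \<omega> - W (real n + real k / 2 ^ j) \<omega>"
    for n j k :: nat and \<omega>
  have [measurable]: "D n j k \<in> borel_measurable M" for n j k unfolding D_def by measurable
  define c where "c n j = 1 / ((real (Suc n))\<^sup>2 * r ^ (4 * j))" for n j :: nat
  have c_pos: "c n j > 0" for n j by (simp add: c_def r_def)
  define T where "T \<omega> = (\<Sum>n j. \<Sum>k<2 ^ j. ennreal (c n j * D n j k \<omega> ^ 4))" for \<omega>
  have moment: "(\<integral>\<^sup>+\<omega>. ennreal (c n j * D n j k \<omega> ^ 4) \<partial>M) = ennreal (c n j * (3 * (1 / 2 ^ j)\<^sup>2))" for n j k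
  proof -
    have "(\<integral>\<^sup>+\<omega>. ennreal (D n j k \<omega> ^ 4) \<partial>M) =
        ennreal (3 * ((real n + real (Suc k) / 2 ^ j) - (real n + real k / 2 ^ j))\<^sup>2)"
      unfolding D_def by (intro wiener_increment_fourth_moment[OF W]) (auto simp: divide_strict_right_mono)
    moreover have "(real n + real (Suc k) / 2 ^ j) - (real n + real k / 2 ^ j) = 1 / 2 ^ j"
      by (simp add: field_simps)
    ultimately have *: "(\<integral>\<^sup>+\<omega>. ennreal (D n j k \<omega> ^ 4) \<partial>M) = ennreal (3 * (1 / 2 ^ j)\<^sup>2)" by simp
    show ?thesis using c_pos[of n j]
      by (simp add: ennreal_mult nn_integral_cmult *)
  qed
  have level: "(\<Sum>k<2 ^ j::nat. ennreal (c n j * (3 * (1 / 2 ^ j)\<^sup>2))) =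
      ennreal (1 / (real (Suc n))\<^sup>2) * ennreal (3 * (5000 / 6561) ^ j)" for n j
  proof -
    have "(2 ^ j) * (c n j * (3 * (1 / 2 ^ j)\<^sup>2)) = 1 / (real (Suc n))\<^sup>2 * (3 * (1 / (2 ^ j * r ^ (4 * j))))"
      by (simp add: c_def power2_eq_square del: of_nat_Suc)
    \<comment> \<open>The ratio is \<open>1 / (2 * r ^ 4)\<close>, less than 1 because
      \<open>r ^ 4 > 1 / 2\<close>.\<close>
    also have "1 / (2 ^ j * r ^ (4 * j)) = (5000 / 6561 :: real) ^ j"
    proof -
      have "2 ^ j * r ^ (4 * j) = (2 * r ^ 4) ^ j" by (simp only: power_mult power_mult_distrib)
      also have "2 * r ^ 4 = 6561 / 5000" by (simp add: r_def power_divide)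
      finally show ?thesis by (simp add: power_divide)
    qed
    finally have *: "(2 ^ j) * (c n j * (3 * (1 / 2 ^ j)\<^sup>2)) = 1 / (real (Suc n))\<^sup>2 * (3 * (5000 / 6561) ^ j)" .
    have "(\<Sum>k<2 ^ j::nat. ennreal (c n j * (3 * (1 / 2 ^ j)\<^sup>2))) = ennreal ((2 ^ j) * (c n j * (3 * (1 / 2 ^ j)\<^sup>2)))"
      using c_pos[of n j] by (subst sum_ennreal) auto
    also have "\<dots> = ennreal (1 / (real (Suc n))\<^sup>2) * ennreal (3 * (5000 / 6561) ^ j)"
      unfolding * by (intro ennreal_mult) auto
    finally show ?thesis .
  qed
  have "(\<integral>\<^sup>+\<omega>. T \<omega> \<partial>M) = (\<Sum>n j. \<Sum>k<2 ^ j::nat. ennreal (c n j * (3 * (1 / 2 ^ j)\<^sup>2)))"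
    unfolding T_def by (simp add: nn_integral_suminf nn_integral_sum moment del: sum_constant)
  also have "\<dots> = (\<Sum>n. ennreal (1 / (real (Suc n))\<^sup>2)) * (\<Sum>j. ennreal (3 * (5000 / 6561) ^ j))"
    unfolding level by (simp only: ennreal_suminf_cmult ennreal_suminf_multc)
  also have "\<dots> < \<infinity>"
  proof -
    have "summable (\<lambda>n. 1 / (real (Suc n))\<^sup>2)"
      using inverse_power_summable[of 2, where 'a = real] 
      by (subst summable_Suc_iff) (simp add: inverse_eq_divide)
    moreover have "summable (\<lambda>j. 3 * (5000 / 6561 :: real) ^ j)"
      by (intro summable_mult summable_geometric) simp
    ultimately show ?thesis by (simp add: suminf_ennreal2 ennreal_mult_less_top)
  qed
  finally have fin: "(\<integral>\<^sup>+\<omega>. T \<omega> \<partial>M) \<noteq> \<infinity>" by simp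
  have "T \<in> borel_measurable M" unfolding T_def by measurable
  from nn_integral_PInf_AE[OF this fin] have "AE \<omega> in M. T \<omega> \<noteq> \<infinity>" .
  moreover have "AE \<omega> in M. continuous_on {0..} (\<lambda>t. W t \<omega>)"
    using W unfolding wiener_process_def by (auto elim: eventually_mono)
  ultimately show ?thesis
  proof eventually_elim
    case (elim \<omega>)
    \<comment> \<open>The maximum with 1 ensures \<open>S \<le> S ^ 4\<close>, so that the bound on
      the fourth power of an increment becomes a fourth power itself.\<close>
    define S where "S = max 1 (enn2real (T \<omega>))"
    have S: "S \<ge> 1" "T \<omega> \<le> ennreal S"
    proof -
      show "S \<ge> 1" by (simp add: S_def)
      have "T \<omega> = ennreal (enn2real (T \<omega>))" using elim(1) by (simp add: less_top)
      also have "\<dots> \<le> ennreal S" by (intro ennreal_leI) (simp add: S_def)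
      finally show "T \<omega> \<le> ennreal S" .
    qed
    have incr: "\<bar>D n j k \<omega>\<bar> \<le> S * sqrt (real (Suc n)) * r ^ j" if "k < 2 ^ j" for n j k
    proof -
      have "ennreal (c n j * D n j k \<omega> ^ 4) \<le> (\<Sum>k<2 ^ j. ennreal (c n j * D n j k \<omega> ^ 4))"
        using that by (intro member_le_sum) auto
      also have "\<dots> \<le> (\<Sum>j. \<Sum>k<2 ^ j. ennreal (c n j * D n j k \<omega> ^ 4))"
        using sum_le_suminf[OF summableI, of "{j}" "\<lambda>j. \<Sum>k<2 ^ j. ennreal (c n j * D n j k \<omega> ^ 4)"] by simp
      also have "\<dots> \<le> T \<omega>"
        using sum_le_suminf[OF summableI, of "{n}" "\<lambda>n. \<Sum>j. \<Sum>k<2 ^ j. ennreal (c n j * D n j k \<omega> ^ 4)"]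
        unfolding T_def by simp
      also note S(2)
      finally have "c n j * D n j k \<omega> ^ 4 \<le> S" using S by (simp add: ennreal_le_iff)
      then have "D n j k \<omega> ^ 4 \<le> S * ((real (Suc n))\<^sup>2 * r ^ (4 * j))"
        by (simp add: c_def r_def field_simps)
      also have "\<dots> \<le> S ^ 4 * ((real (Suc n))\<^sup>2 * r ^ (4 * j))"
        using S(1) self_le_power[of S 4] by (intro mult_right_mono) (auto simp: r_def)
      also have "\<dots> = (S * sqrt (real (Suc n)) * r ^ j) ^ 4"
      proof -
        have pow4: "y ^ 4 = (y\<^sup>2)\<^sup>2" for y :: real by (simp flip: power_mult)
        have "sqrt (real (Suc n)) ^ 4 = (real (Suc n))\<^sup>2" unfolding pow4 by simp
        then show ?thesis by (simp add: power_mult_distrib power_mult[symmetric] mult.commute del: of_nat_Suc)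
      qed
      finally have "\<bar>D n j k \<omega>\<bar> ^ 4 \<le> (S * sqrt (real (Suc n)) * r ^ j) ^ 4" by (simp add: power_even_abs)
      then show ?thesis
        by (rule power_mono_iff[THEN iffD1, rotated -1]) (use S in \<open>auto simp: r_def\<close>)
    qed
    \<comment> \<open>The factor 10 is \<open>1 / (1 - r)\<close> from the chaining bound.\<close>
    have "\<bar>W (real n + s) \<omega> - W (real n) \<omega>\<bar> \<le> 10 * S * sqrt (real (Suc n))" if s: "s \<in> {0..1}" for n s
    proof -
      have "continuous_on {0..1} (\<lambda>s. W (real n + s) \<omega>)"
        by (rule continuous_on_compose2[OF elim(2)]) (auto intro!: continuous_intros)
      from dyadic_chaining[OF this, of r "S * sqrt (real (Suc n))" s] S incr[of _ _ n] s
      have "\<bar>W (real n + s) \<omega> - W (real n + 0) \<omega>\<bar> \<le> S * sqrt (real (Suc n)) / (1 - r)"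
        by (auto simp: r_def D_def)
      then show ?thesis by (simp add: r_def)
    qed
    then show ?case using S(1) by (intro exI[of _ "10 * S"]) auto
  qed
qed

section \<open>Chernoff's inequality, Riemann sums and integrability of the switched drift\<close>

lemma (in prob_space) prob_less_le_exponential_moment:
  assumes [measurable]: "Y \<in> borel_measurable M" and "\<theta> \<ge> 0" "C \<ge> 0"
    and mom: "(\<integral>\<^sup>+\<omega>. ennreal (exp (- \<theta> * Y \<omega>)) \<partial>M) \<le> ennreal C"
  shows "prob {\<omega> \<in> space M. Y \<omega> < b} \<le> exp (\<theta> * b) * C"
proof -
  have "1 \<le> exp (\<theta> * b) * exp (- \<theta> * Y \<omega>)" if "Y \<omega> < b" for \<omega>
  proof -
    have "0 \<le> \<theta> * b + - \<theta> * Y \<omega>" using that \<open>\<theta> \<ge> 0\<close> by (simp add: mult_left_mono)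
    then show ?thesis by (simp only: exp_add[symmetric] one_le_exp_iff)
  qed
  then have "emeasure M {\<omega> \<in> space M. Y \<omega> < b} \<le>
      emeasure M {\<omega> \<in> space M. 1 \<le> ennreal (exp (\<theta> * b)) * ennreal (exp (- \<theta> * Y \<omega>))}"
    by (intro emeasure_mono) (auto simp: ennreal_mult[symmetric] simp del: mult_minus_left)
  also have "\<dots> \<le> ennreal (exp (\<theta> * b)) * (\<integral>\<^sup>+\<omega>. ennreal (exp (- \<theta> * Y \<omega>)) * indicator (space M) \<omega> \<partial>M)"
    by (intro nn_integral_Markov_inequality) auto
  also have "(\<integral>\<^sup>+\<omega>. ennreal (exp (- \<theta> * Y \<omega>)) * indicator (space M) \<omega> \<partial>M) =
      (\<integral>\<^sup>+\<omega>. ennreal (exp (- \<theta> * Y \<omega>)) \<partial>M)"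
    by (intro nn_integral_cong) simp
  also have "ennreal (exp (\<theta> * b)) * \<dots> \<le> ennreal (exp (\<theta> * b)) * ennreal C"
    by (intro mult_left_mono mom) simp
  also have "\<dots> = ennreal (exp (\<theta> * b) * C)" using \<open>C \<ge> 0\<close> by (simp add: ennreal_mult)
  finally show ?thesis using \<open>C \<ge> 0\<close> by (simp add: emeasure_eq_measure)
qed

text \<open>The right endpoint of the grid cell containing \<open>s\<close> approaches
  \<open>s\<close> from the right, so right continuity alone makes the step functions converge
  pointwise, and dominated convergence applies. Measurability of \<open>g\<close> on the interval
  comes out as a by-product of this limit.\<close>

lemma right_continuous_riemann_sum:
  fixes g :: "real \<Rightarrow> real"
  assumes rc: "\<And>s. 0 \<le> s \<Longrightarrow> (g \<longlongrightarrow> g s) (at_right s)" and bd: "\<And>s. 0 \<le> s \<Longrightarrow> \<bar>g s\<bar> \<le> B" and t: "0 < t"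
  shows "set_integrable lborel {0..t} g" (is ?int)
    and "(\<lambda>n. \<Sum>k<Suc n. t / real (Suc n) * g (real (Suc k) * (t / real (Suc n))))
           \<longlonglongrightarrow> (LINT s:{0..t}|lborel. g s)" (is ?lim)
proof -
  define h where "h n = t / real (Suc n)" for n
  have h: "h n > 0" for n using t by (simp add: h_def)
  have hn: "real (Suc n) * h n = t" for n by (simp add: h_def)
  define u where "u n s = (\<Sum>k<Suc n. indicator {real k * h n<..real (Suc k) * h n} s * g (real (Suc k) * h n))" for n s
  define v where "v s = indicator {0<..t} s * g s" for s
  \<comment> \<open>The right endpoint of the cell containing \<open>s\<close>. The cells are open
    on the left and closed on the right, which the ceiling matches.\<close>
  define p where "p n s = of_int \<lceil>s / h n\<rceil> * h n" for n s
  have B: "B \<ge> 0" using bd[of 0] by simp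
  have u_in: "u n s = g (p n s)" if "s \<in> {0<..t}" for n s
  proof -
    define k where "k = nat \<lceil>s / h n\<rceil> - 1"
    have c1: "\<lceil>s / h n\<rceil> \<ge> 1" using that h[of n] by (simp add: one_le_ceiling)
    have "s / h n \<le> of_int (int (Suc n))" using that h[of n] hn[of n] by (simp add: pos_divide_le_eq del: of_nat_Suc)
    then have c2: "\<lceil>s / h n\<rceil> \<le> int (Suc n)" by (rule ceiling_le)
    have k: "\<lceil>s / h n\<rceil> = int (Suc k)" "k < Suc n" using c1 c2 by (auto simp: k_def)
    have "indicator {real j * h n<..real (Suc j) * h n} s = (if j = k then 1 else (0::real))" for j
    proof -
      have "s \<in> {real j * h n<..real (Suc j) * h n} \<longleftrightarrow> real j < s / h n \<and> s / h n \<le> real (Suc j)"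
        using h[of n] by (simp add: pos_divide_le_eq pos_less_divide_eq)
      also have "\<dots> \<longleftrightarrow> \<lceil>s / h n\<rceil> = int (Suc j)" by (simp add: ceiling_eq_iff)
      also have "\<dots> \<longleftrightarrow> j = k" using k by auto
      finally show ?thesis by (simp add: indicator_def)
    qed
    then have "u n s = (\<Sum>j<Suc n. if j = k then g (real (Suc j) * h n) else 0)"
      unfolding u_def by (intro sum.cong) auto
    also have "\<dots> = g (real (Suc k) * h n)" using k(2) by (subst sum.delta) auto
    finally show ?thesis by (simp add: p_def k(1))
  qed
  have u_out: "u n s = 0" if "s \<notin> {0<..t}" for n s
    unfolding u_def
  proof (intro sum.neutral ballI)
    fix k assume "k \<in> {..<Suc n}"
    then have "real (Suc k) * h n \<le> real (Suc n) * h n" using h[of n] by (intro mult_right_mono) auto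
    moreover have "0 \<le> real k * h n" using h[of n] by simp
    ultimately have "s \<notin> {real k * h n<..real (Suc k) * h n}" using that hn[of n] by auto
    then show "indicator {real k * h n<..real (Suc k) * h n} s * g (real (Suc k) * h n) = 0" by simp
  qed
  have h0: "h \<longlonglongrightarrow> 0"
    unfolding h_def using LIMSEQ_Suc[OF lim_const_over_n[of t]] by simp
  have u_lim: "(\<lambda>n. u n s) \<longlonglongrightarrow> v s" for s
  proof (cases "s \<in> {0<..t}")
    case True
    have lo: "s \<le> p n s" for n
      using le_of_int_ceiling[of "s / h n"] unfolding p_def pos_divide_le_eq[OF h] .
    have hi: "p n s \<le> s + h n" for n
    proof -
      have "of_int \<lceil>s / h n\<rceil> \<le> s / h n + 1" by linarith
      then have "p n s \<le> (s / h n + 1) * h n" unfolding p_def using h[of n] by (intro mult_right_mono) auto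
      also have "\<dots> = s + h n" using h[of n] by (simp add: field_simps)
      finally show ?thesis .
    qed
    have "(\<lambda>n. s + h n) \<longlonglongrightarrow> s + 0" by (intro tendsto_intros h0)
    then have p_lim: "(\<lambda>n. p n s) \<longlonglongrightarrow> s"
      by (intro tendsto_sandwich[of "\<lambda>_. s" "\<lambda>n. p n s" sequentially "\<lambda>n. s + h n"]) (auto simp: lo hi)
    have "continuous (at s within {s..}) g"
      using rc[of s] True by (simp add: continuous_within at_within_Ici_at_right)
    then have "(\<lambda>n. g (p n s)) \<longlonglongrightarrow> g s"
      by (rule continuous_within_tendsto_compose) (auto simp: lo p_lim)
    then show ?thesis using True by (simp add: u_in v_def)
  next
    case False
    then show ?thesis by (simp add: u_out v_def)
  qed
  have u_meas [measurable]: "u n \<in> borel_measurable borel" for n unfolding u_def by measurable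
  have v_meas [measurable]: "v \<in> borel_measurable borel"
    by (rule borel_measurable_LIMSEQ_real[where u = u]) (auto simp: u_lim)
  have dom: "integrable lborel (\<lambda>s. B * indicator {0..t} s :: real)"
      using t by (intro integrable_mult_right integrable_real_indicator) auto
  have u_bd: "norm (u n s) \<le> B * indicator {0..t} s" for n s
  proof (cases "s \<in> {0<..t}")
    case True
    then have "0 < s / h n" using h[of n] by simp
    then have "0 \<le> p n s" using h[of n] unfolding p_def by (intro mult_nonneg_nonneg) linarith+
    then show ?thesis using True bd by (simp add: u_in)
  next
    case False then show ?thesis using B by (simp add: u_out)
  qed
  have v_int: "integrable lborel v"
    by (rule integrable_dominated_convergence[OF _ _ dom, of v u]) (use u_bd in \<open>auto simp: u_lim\<close>)
  have lim: "(\<lambda>n. integral\<^sup>L lborel (u n)) \<longlonglongrightarrow> integral\<^sup>L lborel v"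
    by (rule integral_dominated_convergence[OF _ _ dom, of v u]) (use u_bd in \<open>auto simp: u_lim\<close>)
  \<comment> \<open>The cells miss the point 0 of the closed interval; it is restored as a null
    contribution.\<close>
  have v_eq: "(\<lambda>s. indicator {0..t} s *\<^sub>R g s) = (\<lambda>s. v s + indicator {0} s * g 0)"
    using t by (auto simp: fun_eq_iff v_def indicator_def)
  have "integrable lborel (\<lambda>s. indicator {0} s * g 0)" by simp
  then show ?int unfolding set_integrable_def v_eq using v_int by (intro Bochner_Integration.integrable_add)
  have "(LINT s:{0..t}|lborel. g s) = integral\<^sup>L lborel v + (LINT s|lborel. indicator {0} s * g 0)"
    unfolding set_lebesgue_integral_def v_eq using v_int by (subst Bochner_Integration.integral_add) auto
  then have v_val: "(LINT s:{0..t}|lborel. g s) = integral\<^sup>L lborel v" by simp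
  have "integral\<^sup>L lborel (u n) = (\<Sum>k<Suc n. h n * g (real (Suc k) * h n))" for n
  proof -
    have "integral\<^sup>L lborel (u n) =
       (\<Sum>k<Suc n. LINT s|lborel. indicator {real k * h n<..real (Suc k) * h n} s * g (real (Suc k) * h n))"
      unfolding u_def using h[of n]
      by (intro Bochner_Integration.integral_sum) (auto intro!: integrable_mult_left)
    also have "\<dots> = (\<Sum>k<Suc n. h n * g (real (Suc k) * h n))"
      using h[of n] by (intro sum.cong) (auto simp: algebra_simps)
    finally show ?thesis .
  qed
  then show ?lim using lim unfolding v_val h_def by simp
qed

text \<open>Convergence in a discrete space means being eventually constant, so \<open>g\<close> may
  be arbitrary.\<close>

lemma tendsto_compose_discrete:
  fixes f :: "'b \<Rightarrow> 'c::discrete_topology"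
  assumes "(f \<longlongrightarrow> l) F"
  shows "((\<lambda>s. g (f s)) \<longlongrightarrow> g l) F"
proof (rule tendsto_eventually)
  have "eventually (\<lambda>s. f s = l) F" using assms by (simp add: tendsto_discrete)
  then show "eventually (\<lambda>s. g (f s) = g l) F" by eventually_elim simp
qed

text \<open>On the states 0 and 1 the drift equals \<open>Z * bp X + (1 - Z) * bm X\<close>. The
  chain is measurable in time by the Riemann sum lemma, and Borel functions of a continuous path are
  measurable.\<close>

lemma switched_drift_set_integrable:
  fixes X :: "real \<Rightarrow> real" and Z :: "real \<Rightarrow> nat"
  assumes X: "continuous_on {0..} X"
    and Z: "\<And>s. 0 \<le> s \<Longrightarrow> Z s \<in> {0, 1} \<and> (Z \<longlongrightarrow> Z s) (at_right s)"
    and [measurable]: "bp \<in> borel_measurable borel" "bm \<in> borel_measurable borel"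
    and B: "\<And>y. \<bar>bp y\<bar> \<le> B \<and> \<bar>bm y\<bar> \<le> B" and t: "0 \<le> t"
  shows "set_integrable lborel {0..t} (\<lambda>s. switched_drift bp bm (X s) (Z s))"
proof (cases "t = 0")
  case True
  have "(\<lambda>s. indicator {0..t} s *\<^sub>R switched_drift bp bm (X s) (Z s)) =
      (\<lambda>s. indicator {0} s * switched_drift bp bm (X 0) (Z 0))"
    using True by (auto simp: fun_eq_iff indicator_def)
  then show ?thesis unfolding set_integrable_def by simp
next
  case False
  have B0: "B \<ge> 0" using B[of 0] by linarith
  have "set_integrable lborel {0..t} (\<lambda>s. real (Z s))"
  proof (rule right_continuous_riemann_sum(1))
    show "((\<lambda>s. real (Z s)) \<longlongrightarrow> real (Z s)) (at_right s)" if "0 \<le> s" for s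
      using tendsto_compose_discrete[of Z "Z s" "at_right s" real] Z[OF that] by simp
    show "\<bar>real (Z s)\<bar> \<le> 1" if "0 \<le> s" for s
      using Z[OF that] by auto
    show "0 < t" using False t by simp
  qed
  then have v [measurable]: "(\<lambda>s. indicator {0..t} s *\<^sub>R real (Z s)) \<in> borel_measurable borel"
    unfolding set_integrable_def by (auto dest: borel_measurable_integrable)
  \<comment> \<open>Freezing the path at its value at 0 for negative times gives a function
    continuous on the whole line.\<close>
  have "continuous_on UNIV (\<lambda>s. X (max 0 s))"
    by (rule continuous_on_compose2[OF X]) (auto intro!: continuous_intros)
  then have [measurable]: "(\<lambda>s. X (max 0 s)) \<in> borel_measurable borel"
    by (rule borel_measurable_continuous_onI)
  have eq: "indicator {0..t} s *\<^sub>R switched_drift bp bm (X s) (Z s) =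
      (indicator {0..t} s *\<^sub>R real (Z s)) * bp (X (max 0 s)) +
      (indicator {0..t} s - indicator {0..t} s *\<^sub>R real (Z s)) * bm (X (max 0 s))" for s
    using Z[of s] by (auto simp: switched_drift_def indicator_def)
  show ?thesis unfolding set_integrable_def
  proof (rule Bochner_Integration.integrable_bound)
    show "integrable lborel (\<lambda>s. B * indicator {0..t} s :: real)"
      using t by (intro integrable_mult_right integrable_real_indicator) auto
    show "(\<lambda>s. indicator {0..t} s *\<^sub>R switched_drift bp bm (X s) (Z s)) \<in> borel_measurable lborel"
      unfolding eq by measurable
    show "AE s in lborel. norm (indicator {0..t} s *\<^sub>R switched_drift bp bm (X s) (Z s))
        \<le> norm (B * indicator {0..t} s :: real)"
      using B B0 by (auto simp: switched_drift_def indicator_def)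
  qed
qed

lemma WZ_filtration_subset:
  assumes [measurable]: "\<And>t. W t \<in> borel_measurable M" "\<And>t. Z t \<in> measurable M (count_space UNIV)"
  shows "sets (WZ_filtration M W Z t) \<subseteq> sets M"
proof -
  let ?G = "{W s -` A \<inter> space M | s A. 0 \<le> s \<and> s \<le> t \<and> A \<in> sets borel} \<union>
      {Z s -` A \<inter> space M | s A. 0 \<le> s \<and> s \<le> t} \<union> null_sets M"
  have G: "?G \<subseteq> sets M"
    by (auto intro!: measurable_sets[OF assms(1)] measurable_sets[OF assms(2)])
  then have "?G \<subseteq> Pow (space M)" using sets.space_closed by (rule subset_trans)
  then have "sets (WZ_filtration M W Z t) = sigma_sets (space M) ?G"
    unfolding WZ_filtration_def by (rule sets_measure_of)
  then show ?thesis using sets.sigma_sets_subset[OF G] by simp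
qed

section \<open>The switched diffusion: splitting off the Wiener process and comparing the drift with
  the chain\<close>

locale switched_diffusion = prob_space M for M :: "'a measure" +
  fixes W X :: "real \<Rightarrow> 'a \<Rightarrow> real" and Z :: "real \<Rightarrow> 'a \<Rightarrow> nat"
    and bp bm :: "real \<Rightarrow> real" and lp lm rp rm x :: real and z :: nat
  assumes rates: "lp > 0" "lm > 0"
    and z: "z \<in> {0, 1}"
    and wiener: "wiener_process M W"
    and chain: "two_state_chain M lp lm z Z"
    and drift_measurable: "bp \<in> borel_measurable borel" "bm \<in> borel_measurable borel"
    and drift_bounded: "\<exists>B. \<forall>y. \<bar>bp y\<bar> \<le> B \<and> \<bar>bm y\<bar> \<le> B"
    and solution: "strong_solution M bp bm x W Z X"
    and r_pos: "rp > 0" "rm > 0"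
    and bp_ge: "\<And>y. bp y \<ge> rp" and bm_ge: "\<And>y. bm y \<ge> - rm"
    and ratio: "rp / lp > rm / lm"
begin

text \<open>The mean of the drift bound \<open>rp\<close>, \<open>- rm\<close> under the stationary law
  \<open>(lp, lm) / (lp + lm)\<close> of the chain on \<open>(0, 1)\<close>.\<close>
definition mean_drift :: real where
  "mean_drift = (rp * lm - rm * lp) / (lp + lm)"

definition drift_bound :: "nat \<Rightarrow> real" where
  "drift_bound k = (if k = 1 then rp else - rm)"

text \<open>Defining it by subtraction gives measurability at once; it agrees with the integrated
  drift only almost surely.\<close>

definition drift_part :: "real \<Rightarrow> 'a \<Rightarrow> real" where
  "drift_part t \<omega> = X t \<omega> - x - W t \<omega>"

text \<open>The oscillation of the solution \<open>g\<close> of the Poisson equation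
  \<open>Q g = drift_bound - mean_drift\<close> for the generator \<open>Q\<close> of the chain.\<close>
definition osc :: real where
  "osc = (rp + rm) / (lp + lm)"

lemma mean_drift_pos: "mean_drift > 0"
  using ratio rates by (simp add: mean_drift_def field_simps)

lemma osc_pos: "osc > 0"
  using r_pos rates by (simp add: osc_def)

lemma W_measurable [measurable]: "W t \<in> borel_measurable M"
  using wiener by (simp add: wiener_process_def)

lemma Z_measurable [measurable]: "Z t \<in> measurable M (count_space UNIV)"
  using chain by (simp add: two_state_chain_def)

lemma X_measurable:
  assumes "t \<ge> 0"
  shows "X t \<in> borel_measurable M"
proof (rule measurableI)
  have sp: "space (WZ_filtration M W Z t) = space M"
    by (simp add: WZ_filtration_def space_measure_of_conv)
  have X: "X t \<in> borel_measurable (WZ_filtration M W Z t)"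
    using solution assms by (simp add: strong_solution_def)
  show "X t -` A \<inter> space M \<in> sets M" if "A \<in> sets borel" for A
    using measurable_sets[OF X that] WZ_filtration_subset[of W M Z t] unfolding sp by auto
qed simp

lemma drift_part_measurable:
  "t \<ge> 0 \<Longrightarrow> drift_part t \<in> borel_measurable M"
  unfolding drift_part_def[abs_def] using X_measurable[of t] by measurable

text \<open>Integrability is recorded along with the equation because an integral of a
  non-integrable drift would be 0 by default, and the later estimates split and compare
  integrals.\<close>

lemma AE_regular_path:
  "AE \<omega> in M. continuous_on {0..} (\<lambda>t. X t \<omega>)
     \<and> (\<forall>t\<ge>0. Z t \<omega> \<in> {0, 1} \<and> ((\<lambda>s. Z s \<omega>) \<longlongrightarrow> Z t \<omega>) (at_right t))
     \<and> (\<forall>t\<ge>0. drift_part t \<omega> = (LINT s:{0..t}|lborel. switched_drift bp bm (X s \<omega>) (Z s \<omega>)))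
     \<and> (\<forall>t\<ge>0. set_integrable lborel {0..t} (\<lambda>s. switched_drift bp bm (X s \<omega>) (Z s \<omega>)))"
proof -
  obtain B where B: "\<And>y. \<bar>bp y\<bar> \<le> B \<and> \<bar>bm y\<bar> \<le> B" using drift_bounded by blast
  have "AE \<omega> in M. continuous_on {0..} (\<lambda>t. X t \<omega>) \<and>
      (\<forall>t\<ge>0. X t \<omega> = x + (LINT s:{0..t}|lborel. switched_drift bp bm (X s \<omega>) (Z s \<omega>)) + W t \<omega>)"
    using solution by (simp add: strong_solution_def)
  moreover have "AE \<omega> in M. \<forall>t\<ge>0. Z t \<omega> \<in> {0, 1} \<and> ((\<lambda>s. Z s \<omega>) \<longlongrightarrow> Z t \<omega>) (at_right t)"
    using chain by (simp add: two_state_chain_def)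
  ultimately show ?thesis
  proof eventually_elim
    case (elim \<omega>)
    have "set_integrable lborel {0..t} (\<lambda>s. switched_drift bp bm (X s \<omega>) (Z s \<omega>))" if "t \<ge> 0" for t
      using elim that by (intro switched_drift_set_integrable[OF _ _ drift_measurable B]) auto
    then show ?case using elim unfolding drift_part_def by (simp add: algebra_simps)
  qed
qed

lemma switched_drift_ge: "switched_drift bp bm y k \<ge> drift_bound k"
  using bp_ge bm_ge by (simp add: switched_drift_def drift_bound_def)

text \<open>In both regimes the drift is at least \<open>- rm\<close>, since \<open>rp\<close> is
  positive. This controls the loss between integer times.\<close>

lemma drift_part_decrement:
  "AE \<omega> in M. \<forall>s t. 0 \<le> s \<longrightarrow> s \<le> t \<longrightarrow> drift_part t \<omega> \<ge> drift_part s \<omega> - rm * (t - s)"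
  using AE_regular_path
proof eventually_elim
  case (elim \<omega>)
  let ?b = "\<lambda>s. switched_drift bp bm (X s \<omega>) (Z s \<omega>)"
  show ?case
  proof (intro allI impI)
    fix s t :: real assume st: "0 \<le> s" "s \<le> t"
    have int_t: "set_integrable lborel {0..t} ?b" using elim st by simp
    have int1: "set_integrable lborel {0..s} ?b" and int2: "set_integrable lborel {s<..t} ?b"
      using st by (auto intro: set_integrable_subset[OF int_t])
    have "{0..t} = {0..s} \<union> {s<..t}" using st by auto
    moreover have "(LINT u:{0..s} \<union> {s<..t}|lborel. ?b u) =
        (LINT u:{0..s}|lborel. ?b u) + (LINT u:{s<..t}|lborel. ?b u)"
      by (rule set_integral_Un[OF _ int1 int2]) auto
    ultimately have "drift_part t \<omega> = drift_part s \<omega> + (LINT u:{s<..t}|lborel. ?b u)"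
      using elim st by simp
    moreover have "(LINT u:{s<..t}|lborel. - rm) \<le> (LINT u:{s<..t}|lborel. ?b u)"
    proof (rule set_integral_mono[OF _ int2])
      show "set_integrable lborel {s<..t} (\<lambda>_. - rm)"
        unfolding set_integrable_def by (rule integrable_scaleR_left, rule integrable_real_indicator) (use st in auto)
      show "- rm \<le> ?b u" for u
        using switched_drift_ge[of "Z u \<omega>" "X u \<omega>"] r_pos by (simp add: drift_bound_def split: if_splits)
    qed
    moreover have "(LINT u:{s<..t}|lborel. - rm) = - rm * (t - s)"
      using st by (simp add: set_lebesgue_integral_def)
    ultimately show "drift_part t \<omega> \<ge> drift_part s \<omega> - rm * (t - s)" by simp
  qed
qed

section \<open>Exponential tail bounds\<close>

text \<open>The chain product bound with weights \<open>exp (- \<theta> * h * drift_bound j)\<close>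
  costs \<open>exp (\<mu> * h)\<close> per step, hence \<open>exp (\<mu> * t)\<close> in total, for
  every sufficiently fine grid. The strict inequality for \<open>\<mu>\<close> leaves room for the
  discretisation error.\<close>

lemma drift_part_exponential_moment:
  assumes t: "t > 0" and \<theta>: "\<theta> > 0"
    and \<mu>: "- \<theta> * (mean_drift - \<theta> * ((mean_drift + rm) * osc)) < \<mu>"
  shows "(\<integral>\<^sup>+\<omega>. ennreal (exp (- \<theta> * drift_part t \<omega>)) \<partial>M) \<le> ennreal ((1 + \<theta> * osc) * exp (\<mu> * t))"
proof -
  define \<phi> where "\<phi> i = (if i = (1::nat) then 1 else 1 + \<theta> * osc)" for i
  have \<phi>1: "1 \<le> \<phi> i" "\<phi> i \<le> 1 + \<theta> * osc" for i using \<theta> osc_pos by (auto simp: \<phi>_def)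
  define h where "h n = t / real (Suc n)" for n
  have h: "h n > 0" for n using t by (simp add: h_def)
  have hn: "real (Suc n) * h n = t" for n by (simp add: h_def)
  define R where "R n \<omega> = (\<Sum>k<Suc n. h n * drift_bound (Z (real (Suc k) * h n) \<omega>))" for n \<omega>
  have [measurable]: "(\<lambda>\<omega>. drift_bound (Z s \<omega>)) \<in> borel_measurable M" for s
    by (rule measurable_compose[OF Z_measurable]) simp
  have [measurable]: "R n \<in> borel_measurable M" for n unfolding R_def by measurable
  have "filterlim h (at_right 0) sequentially"
    unfolding filterlim_at using LIMSEQ_Suc[OF lim_const_over_n[of t]] t by (simp add: h_def[abs_def])
  moreover have "eventually (\<lambda>h. \<forall>i\<in>{0, 1}. (\<Sum>j\<in>{0, 1}. two_state_trans lp lm h i j *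
      exp (- \<theta> * h * drift_bound j) * \<phi> j) \<le> exp (\<mu> * h) * \<phi> i) (at_right 0)"
    unfolding \<phi>_def drift_bound_def osc_def
    using rates r_pos mean_drift_pos \<theta> \<mu> unfolding mean_drift_def osc_def
    by (intro eventually_ball_finite ballI two_state_generator_bound) auto
  ultimately have ev: "eventually (\<lambda>n. \<forall>i\<in>{0, 1}. (\<Sum>j\<in>{0, 1}. two_state_trans lp lm (h n) i j *
      exp (- \<theta> * h n * drift_bound j) * \<phi> j) \<le> exp (\<mu> * h n) * \<phi> i) sequentially"
    unfolding filterlim_iff by blast
  have bound: "eventually (\<lambda>n. (\<integral>\<^sup>+\<omega>. ennreal (exp (- \<theta> * R n \<omega>)) \<partial>M)
      \<le> ennreal ((1 + \<theta> * osc) * exp (\<mu> * t))) sequentially"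
    using ev
  proof eventually_elim
    case (elim n)
    define a where "a j = exp (- \<theta> * h n * drift_bound j)" for j
    have exp_R: "exp (- \<theta> * R n \<omega>) = (\<Prod>k<Suc n. a (Z (real (Suc k) * h n) \<omega>))" for \<omega>
      unfolding R_def a_def by (subst exp_sum[symmetric]) (auto simp: sum_distrib_left mult_ac simp del: of_nat_Suc sum.lessThan_Suc)
    have "(\<integral>\<^sup>+\<omega>. ennreal (exp (- \<theta> * R n \<omega>)) \<partial>M) \<le>
      (\<integral>\<^sup>+\<omega>. (\<Prod>k<Suc n. ennreal (a (Z (real (Suc k) * h n) \<omega>))) * ennreal (\<phi> (Z (real (Suc n) * h n) \<omega>)) \<partial>M)"
    proof (rule nn_integral_mono)
      fix \<omega>
      have "ennreal (exp (- \<theta> * R n \<omega>)) = (\<Prod>k<Suc n. ennreal (a (Z (real (Suc k) * h n) \<omega>))) * ennreal 1"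
        unfolding exp_R by (subst prod_ennreal) (auto simp: a_def)
      \<comment> \<open>As \<open>\<phi>\<close> is at least 1, the terminal factor required by the
        chain product bound can be inserted.\<close>
      also have "\<dots> \<le> (\<Prod>k<Suc n. ennreal (a (Z (real (Suc k) * h n) \<omega>))) * ennreal (\<phi> (Z (real (Suc n) * h n) \<omega>))"
        by (intro mult_left_mono ennreal_leI \<phi>1) simp
      finally show "ennreal (exp (- \<theta> * R n \<omega>)) \<le> \<dots>" .
    qed
    also have "\<dots> \<le> ennreal (exp (\<mu> * h n)) ^ Suc n * ennreal (\<phi> z)"
    proof (rule nn_integral_chain_product_le[OF chain rates h z])
      fix i :: nat assume i: "i \<in> {0, 1}"
      have nn: "0 \<le> two_state_trans lp lm (h n) i j" for j
        using rates h[of n] by (intro two_state_trans_nonneg) auto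
      have \<phi>0: "0 \<le> \<phi> j" for j using \<phi>1(1)[of j] by simp
      have "(\<Sum>j\<in>{0, 1}. ennreal (two_state_trans lp lm (h n) i j) * ennreal (a j) * ennreal (\<phi> j)) =
          ennreal (\<Sum>j\<in>{0, 1}. two_state_trans lp lm (h n) i j * a j * \<phi> j)"
        using nn \<phi>0 by (subst sum_ennreal[symmetric]) (auto simp: a_def ennreal_mult)
      also have "\<dots> \<le> ennreal (exp (\<mu> * h n) * \<phi> i)"
        using elim i unfolding a_def by (intro ennreal_leI) blast
      also have "\<dots> = ennreal (exp (\<mu> * h n)) * ennreal (\<phi> i)" using \<phi>0 by (simp add: ennreal_mult)
      finally show "(\<Sum>j\<in>{0, 1}. ennreal (two_state_trans lp lm (h n) i j) * ennreal (a j) * ennreal (\<phi> j))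
          \<le> ennreal (exp (\<mu> * h n)) * ennreal (\<phi> i)" .
    qed
    also have "ennreal (exp (\<mu> * h n)) ^ Suc n = ennreal (exp (\<mu> * t))"
    proof -
      have "exp (\<mu> * h n) ^ Suc n = exp (real (Suc n) * (\<mu> * h n))" by (rule exp_of_nat_mult[symmetric])
      also have "real (Suc n) * (\<mu> * h n) = \<mu> * t" using hn[of n] by (simp add: mult.left_commute)
      finally show ?thesis by (subst ennreal_power) auto
    qed
    also have "ennreal (exp (\<mu> * t)) * ennreal (\<phi> z) \<le> ennreal (exp (\<mu> * t)) * ennreal (1 + \<theta> * osc)"
      by (intro mult_left_mono ennreal_leI \<phi>1) simp
    also have "\<dots> = ennreal ((1 + \<theta> * osc) * exp (\<mu> * t))"
      using \<theta> osc_pos by (subst ennreal_mult[symmetric]) (auto simp: mult.commute)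
    finally show ?case .
  qed
  \<comment> \<open>Input for Fatou's lemma: the Riemann sums converge to the integral of
    \<open>drift_bound\<close> along the chain, which \<open>drift_part t\<close> dominates.\<close>
  have "AE \<omega> in M. ennreal (exp (- \<theta> * drift_part t \<omega>)) \<le> liminf (\<lambda>n. ennreal (exp (- \<theta> * R n \<omega>)))"
    using AE_regular_path
  proof eventually_elim
    case (elim \<omega>)
    let ?g = "\<lambda>s. drift_bound (Z s \<omega>)"
    have rc: "(?g \<longlongrightarrow> ?g s) (at_right s)" if "0 \<le> s" for s
      using tendsto_compose_discrete[of "\<lambda>s. Z s \<omega>" "Z s \<omega>" "at_right s" drift_bound] elim that by simp
    have bd: "\<bar>?g s\<bar> \<le> max rp rm" for s using r_pos by (simp add: drift_bound_def)
    note riemann = right_continuous_riemann_sum[of ?g "max rp rm" t, OF rc bd t]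
    have "(LINT s:{0..t}|lborel. ?g s) \<le> (LINT s:{0..t}|lborel. switched_drift bp bm (X s \<omega>) (Z s \<omega>))"
      using elim t riemann(1) by (intro set_integral_mono switched_drift_ge) auto
    then have "(LINT s:{0..t}|lborel. ?g s) \<le> drift_part t \<omega>" using elim t by simp
    then have le: "ennreal (exp (- \<theta> * drift_part t \<omega>)) \<le> ennreal (exp (- \<theta> * (LINT s:{0..t}|lborel. ?g s)))"
      using \<theta> by (intro ennreal_leI) simp
    have "(\<lambda>n. R n \<omega>) \<longlonglongrightarrow> (LINT s:{0..t}|lborel. ?g s)"
      using riemann(2) unfolding R_def h_def by simp
    then have "(\<lambda>n. ennreal (exp (- \<theta> * R n \<omega>))) \<longlonglongrightarrow> ennreal (exp (- \<theta> * (LINT s:{0..t}|lborel. ?g s)))"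
      by (intro tendsto_intros)
    then have "liminf (\<lambda>n. ennreal (exp (- \<theta> * R n \<omega>))) = ennreal (exp (- \<theta> * (LINT s:{0..t}|lborel. ?g s)))"
      by (intro lim_imp_Liminf) auto
    then show ?case using le by simp
  qed
  then have "(\<integral>\<^sup>+\<omega>. ennreal (exp (- \<theta> * drift_part t \<omega>)) \<partial>M) \<le>
      (\<integral>\<^sup>+\<omega>. liminf (\<lambda>n. ennreal (exp (- \<theta> * R n \<omega>))) \<partial>M)"
    by (rule nn_integral_mono_AE)
  also have "\<dots> \<le> liminf (\<lambda>n. \<integral>\<^sup>+\<omega>. ennreal (exp (- \<theta> * R n \<omega>)) \<partial>M)"
    by (rule nn_integral_liminf) measurable
  also have "\<dots> \<le> limsup (\<lambda>n. \<integral>\<^sup>+\<omega>. ennreal (exp (- \<theta> * R n \<omega>)) \<partial>M)"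
    by (intro Liminf_le_Limsup) simp
  also have "\<dots> \<le> ennreal ((1 + \<theta> * osc) * exp (\<mu> * t))"
    by (rule Limsup_bounded[OF bound])
  finally show ?thesis .
qed

text \<open>A deficit of \<open>\<epsilon> * t\<close> forces a deficit of
  \<open>\<epsilon> / 2 * t\<close> in the drift part or in the Wiener part. Chernoff's inequality
  with the same \<open>\<theta>\<close> handles both.\<close>

lemma lower_tail_exponentially_small:
  assumes \<epsilon>: "\<epsilon> > 0"
  shows "\<exists>\<kappa>. 0 < \<kappa> \<and> \<kappa> < 1 \<and> (\<exists>t0>0. \<forall>t\<ge>t0.
    prob {\<omega> \<in> space M. (X t \<omega> - x) / t - mean_drift < - \<epsilon>} < \<kappa> powr t)"
proof -
  define K where "K = (mean_drift + rm) * osc"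
  have K: "K > 0" using mean_drift_pos r_pos osc_pos by (simp add: K_def)
  \<comment> \<open>Small enough that both second-order errors, \<open>2 * \<theta> * K\<close> for
    the drift and \<open>\<theta> / 2\<close> for the Wiener process, are at most
    \<open>\<epsilon> / 4\<close>. Each tail then decays at rate at least
    \<open>\<beta>\<close>.\<close>
  define \<theta> where "\<theta> = \<epsilon> / (8 * K + 2)"
  have \<theta>: "\<theta> > 0" using \<epsilon> K by (simp add: \<theta>_def)
  have \<theta>_eq: "\<theta> * (8 * K + 2) = \<epsilon>" using K by (simp add: \<theta>_def)
  have \<theta>K: "2 * \<theta> * K \<le> \<epsilon> / 4" and \<theta>2: "\<theta> / 2 \<le> \<epsilon> / 4"
    using \<theta> K mult_pos_pos[OF \<theta> K] \<theta>_eq by (auto simp: algebra_simps)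
  define \<beta> where "\<beta> = \<theta> * (\<epsilon> / 4)"
  have \<beta>: "\<beta> > 0" using \<theta> \<epsilon> by (simp add: \<beta>_def)
  define C where "C = 2 + \<theta> * osc"
  have C: "C > 0" using \<theta> osc_pos by (simp add: C_def add_pos_pos)
  \<comment> \<open>From \<open>t0\<close> on, \<open>exp (\<beta> / 2 * t)\<close> exceeds the sum
    \<open>C\<close> of the two prefactors, so half of the decay rate survives as
    \<open>\<kappa> = exp (- \<beta> / 2)\<close>.\<close>
  define t0 where "t0 = 2 * C / \<beta>"
  have tail: "prob {\<omega> \<in> space M. (X t \<omega> - x) / t - mean_drift < - \<epsilon>} < exp (- \<beta> / 2) powr t" if "t \<ge> t0" for t
  proof -
    have t0: "t0 > 0" using C \<beta> by (simp add: t0_def)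
    then have t: "t > 0" using that by simp
    note [measurable] = X_measurable[of t] drift_part_measurable[of t]
    have [measurable]: "drift_part t \<in> borel_measurable M" using t by simp
    have "{\<omega> \<in> space M. (X t \<omega> - x) / t - mean_drift < - \<epsilon>} \<subseteq>
       {\<omega> \<in> space M. drift_part t \<omega> < (mean_drift - \<epsilon> / 2) * t} \<union> {\<omega> \<in> space M. W t \<omega> < - (\<epsilon> / 2) * t}"
    proof
      fix \<omega> assume "\<omega> \<in> {\<omega> \<in> space M. (X t \<omega> - x) / t - mean_drift < - \<epsilon>}"
      then have w: "\<omega> \<in> space M" "(X t \<omega> - x) / t < mean_drift - \<epsilon>" by auto
      then have "X t \<omega> - x < (mean_drift - \<epsilon>) * t" using t by (simp add: pos_divide_less_eq)
      also have "\<dots> = (mean_drift - \<epsilon> / 2) * t + - (\<epsilon> / 2) * t" by (simp add: algebra_simps)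
      finally have "drift_part t \<omega> + W t \<omega> < (mean_drift - \<epsilon> / 2) * t + - (\<epsilon> / 2) * t"
        by (simp add: drift_part_def)
      then show "\<omega> \<in> {\<omega> \<in> space M. drift_part t \<omega> < (mean_drift - \<epsilon> / 2) * t} \<union> {\<omega> \<in> space M. W t \<omega> < - (\<epsilon> / 2) * t}"
        using w(1) by auto
    qed
    then have "prob {\<omega> \<in> space M. (X t \<omega> - x) / t - mean_drift < - \<epsilon>} \<le>
       prob ({\<omega> \<in> space M. drift_part t \<omega> < (mean_drift - \<epsilon> / 2) * t} \<union> {\<omega> \<in> space M. W t \<omega> < - (\<epsilon> / 2) * t})"
      by (intro finite_measure_mono) measurable
    also have "\<dots> \<le> prob {\<omega> \<in> space M. drift_part t \<omega> < (mean_drift - \<epsilon> / 2) * t} +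
        prob {\<omega> \<in> space M. W t \<omega> < - (\<epsilon> / 2) * t}"
      by (intro measure_Un_le) measurable
    also have "prob {\<omega> \<in> space M. drift_part t \<omega> < (mean_drift - \<epsilon> / 2) * t} \<le> (1 + \<theta> * osc) * exp (- \<beta> * t)"
    proof -
      \<comment> \<open>Doubling the second-order term provides the strict inequality that the
        moment bound asks for.\<close>
      define \<mu> where "\<mu> = - \<theta> * (mean_drift - 2 * \<theta> * K)"
      have "- \<theta> * (mean_drift - \<theta> * ((mean_drift + rm) * osc)) < \<mu>"
        using \<theta> K by (simp add: \<mu>_def K_def[symmetric])
      note mom = drift_part_exponential_moment[OF t \<theta> this]
      have "prob {\<omega> \<in> space M. drift_part t \<omega> < (mean_drift - \<epsilon> / 2) * t} \<le>
          exp (\<theta> * ((mean_drift - \<epsilon> / 2) * t)) * ((1 + \<theta> * osc) * exp (\<mu> * t))"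
        using \<theta> osc_pos by (intro prob_less_le_exponential_moment mom) auto
      also have "\<dots> = (1 + \<theta> * osc) * exp (- \<theta> * t * (\<epsilon> / 2 - 2 * \<theta> * K))"
        by (simp add: \<mu>_def exp_add[symmetric] algebra_simps)
      also have "\<dots> \<le> (1 + \<theta> * osc) * exp (- \<beta> * t)"
      proof -
        have "\<theta> * t * (\<epsilon> / 4) \<le> \<theta> * t * (\<epsilon> / 2 - 2 * \<theta> * K)"
          using \<theta> t \<theta>K by (intro mult_left_mono) auto
        then have "- \<theta> * t * (\<epsilon> / 2 - 2 * \<theta> * K) \<le> - \<beta> * t" by (simp add: \<beta>_def mult_ac)
        then show ?thesis using \<theta> osc_pos by (intro mult_left_mono) auto
      qed
      finally show ?thesis .
    qed
    also have "prob {\<omega> \<in> space M. W t \<omega> < - (\<epsilon> / 2) * t} \<le> exp (- \<beta> * t)"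
    proof -
      have "prob {\<omega> \<in> space M. W t \<omega> < - (\<epsilon> / 2) * t} \<le> exp (\<theta> * (- (\<epsilon> / 2) * t)) * exp (\<theta>\<^sup>2 * t / 2)"
        using \<theta> wiener_exponential_moment[OF wiener t, of \<theta>]
        by (intro prob_less_le_exponential_moment) auto
      also have "\<dots> = exp (- \<theta> * t * (\<epsilon> / 2 - \<theta> / 2))"
        by (simp add: exp_add[symmetric] algebra_simps power2_eq_square)
      also have "\<dots> \<le> exp (- \<beta> * t)"
      proof -
        have "\<theta> * t * (\<epsilon> / 4) \<le> \<theta> * t * (\<epsilon> / 2 - \<theta> / 2)"
          using \<theta> t \<theta>2 by (intro mult_left_mono) auto
        then show ?thesis by (simp add: \<beta>_def mult_ac)
      qed
      finally show ?thesis .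
    qed
    also have "(1 + \<theta> * osc) * exp (- \<beta> * t) + exp (- \<beta> * t) = C * exp (- \<beta> * t)"
      by (simp add: C_def algebra_simps)
    also have "\<dots> < exp (\<beta> / 2 * t) * exp (- \<beta> * t)"
    proof (rule mult_strict_right_mono)
      have "C = \<beta> / 2 * t0" using \<beta> by (simp add: t0_def)
      also have "\<dots> \<le> \<beta> / 2 * t" using that \<beta> by (intro mult_left_mono) auto
      also have "\<dots> < 1 + \<beta> / 2 * t" by simp
      also have "\<dots> \<le> exp (\<beta> / 2 * t)" by (rule exp_ge_add_one_self)
      finally show "C < exp (\<beta> / 2 * t)" .
    qed simp
    also have "\<dots> = exp (- \<beta> / 2) powr t"
      by (simp add: powr_def exp_add[symmetric] algebra_simps)
    finally show ?thesis by simp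
  qed
  have "t0 > 0" using C \<beta> by (simp add: t0_def)
  then show ?thesis using tail \<beta> by (intro exI[of _ "exp (- \<beta> / 2)"]) auto
qed

section \<open>Almost sure linear growth\<close>

text \<open>The tail bound is summable over integer times, so Borel-Cantelli gives slope
  \<open>mean_drift / 2\<close> there. Between integers the drift part loses at most
  \<open>rm\<close> and \<open>W\<close> moves by \<open>O(sqrt t)\<close>; half of the slope
  absorbs both losses.\<close>

lemma AE_eventually_linear_growth:
  "AE \<omega> in M. eventually (\<lambda>t. mean_drift / 4 * t \<le> X t \<omega>) at_top"
proof -
  let ?c = mean_drift
  have c: "?c > 0" by (rule mean_drift_pos)
  \<comment> \<open>Division by zero makes \<open>A 0\<close> the whole space; only large
    \<open>n\<close> matter.\<close>
  define A where "A n = {\<omega> \<in> space M. (X (real n) \<omega> - x) / real n - ?c < - (?c / 2)}" for n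
  have A_sets: "A n \<in> sets M" for n
    unfolding A_def using X_measurable[of "real n"] by measurable
  obtain \<kappa> t0 where \<kappa>: "0 < \<kappa>" "\<kappa> < 1"
    and t0: "\<And>t. t \<ge> t0 \<Longrightarrow> prob {\<omega> \<in> space M. (X t \<omega> - x) / t - ?c < - (?c / 2)} < \<kappa> powr t"
    using lower_tail_exponentially_small[of "?c / 2"] c by auto
  have "summable (\<lambda>n. prob (A n))"
  proof (rule summable_comparison_test_ev)
    have "eventually (\<lambda>n. real n \<ge> t0) sequentially"
      by (rule filterlim_real_sequentially[THEN filterlim_at_top[THEN iffD1], rule_format])
    then show "eventually (\<lambda>n. norm (prob (A n)) \<le> \<kappa> ^ n) sequentially"
    proof eventually_elim
      case (elim n)
      then have "prob (A n) < \<kappa> powr real n" unfolding A_def by (rule t0)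
      then show ?case using \<kappa> by (simp add: powr_realpow)
    qed
    show "summable (\<lambda>n. \<kappa> ^ n)" using \<kappa> by (intro summable_geometric) simp
  qed
  then have "AE \<omega> in M. eventually (\<lambda>n. \<omega> \<in> space M - A n) sequentially"
    by (intro borel_cantelli_AE1 A_sets) (auto simp: emeasure_eq_measure)
  with drift_part_decrement wiener_unit_interval_fluctuation[OF wiener]
  show ?thesis
  proof eventually_elim
    case (elim \<omega>)
    obtain S where S: "S \<ge> 0" "\<And>n s. s \<in> {0..1} \<Longrightarrow>
        \<bar>W (real n + s) \<omega> - W (real n) \<omega>\<bar> \<le> S * sqrt (real (Suc n))"
      using elim(2) by blast
    obtain N where N: "\<And>n. n \<ge> N \<Longrightarrow> \<omega> \<in> space M - A n"
      using elim(3) by (auto simp: eventually_sequentially)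
    \<comment> \<open>Of the slope \<open>?c / 2\<close>, the fluctuation of \<open>W\<close> takes
      \<open>?c / 8\<close> and the claim \<open>?c / 4\<close>. The remaining \<open>?c / 8\<close>
      outweighs all constants once \<open>t \<ge> T\<close>; the term \<open>5 / 8 * ?c\<close>
      collects the shifts in \<open>t - 1\<close> and \<open>t + 1\<close>.\<close>
    define T where "T = 8 / ?c * (rm + 5 / 8 * ?c + 2 * S\<^sup>2 / ?c - x)"
    have "?c / 4 * t \<le> X t \<omega>" if t: "t \<ge> 1" "t \<ge> real N + 1" "t \<ge> T" for t
    proof -
      define n where "n = nat \<lfloor>t\<rfloor>"
      have n_t: "real n \<le> t" "t < real n + 1" using t by (auto simp: n_def)
      then have n: "n \<ge> 1" "n \<ge> N" using t by auto
      have "\<not> (X (real n) \<omega> - x) / real n - ?c < - (?c / 2)" using N[OF n(2)] by (simp add: A_def)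
      then have "?c / 2 \<le> (X (real n) \<omega> - x) / real n" by linarith
      moreover have "real n > 0" using n by simp
      ultimately have Xn: "X (real n) \<omega> \<ge> x + ?c / 2 * real n" by (simp add: pos_le_divide_eq)
      have "rm * (t - real n) \<le> rm * 1" using n_t r_pos by (intro mult_left_mono) auto
      then have J: "drift_part t \<omega> \<ge> drift_part (real n) \<omega> - rm"
        using elim(1)[rule_format, of "real n" t] n_t by simp
      have "\<bar>W t \<omega> - W (real n) \<omega>\<bar> \<le> S * sqrt (real (Suc n))"
        using S(2)[of "t - real n" n] n_t by simp
      also have "\<dots> \<le> S * sqrt (t + 1)" using S(1) n_t by (intro mult_left_mono) auto
      \<comment> \<open>AM-GM\<close>
      also have "\<dots> \<le> ?c / 8 * (t + 1) + 2 * S\<^sup>2 / ?c"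
      proof -
        define y where "y = sqrt (t + 1)"
        have y: "y\<^sup>2 = t + 1" using t by (simp add: y_def)
        have "0 \<le> (?c * y - 4 * S)\<^sup>2 / (8 * ?c)" using c by simp
        also have "\<dots> = ?c / 8 * y\<^sup>2 + 2 * S\<^sup>2 / ?c - S * y"
          using c by (simp add: field_simps power2_eq_square)
        finally show ?thesis unfolding y by (simp add: y_def)
      qed
      finally have Wb: "W t \<omega> \<ge> W (real n) \<omega> - (?c / 8 * (t + 1) + 2 * S\<^sup>2 / ?c)" by linarith
      have "?c / 2 * real n \<ge> ?c / 2 * (t - 1)" using n_t c by (intro mult_left_mono) auto
      then have "X t \<omega> \<ge> x + ?c / 2 * (t - 1) - rm - (?c / 8 * (t + 1) + 2 * S\<^sup>2 / ?c)"
        using Xn J Wb by (simp add: drift_part_def)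
      moreover have "?c / 8 * t \<ge> ?c / 8 * T" using t c by (intro mult_left_mono) auto
      moreover have "?c / 8 * T = rm + 5 / 8 * ?c + 2 * S\<^sup>2 / ?c - x" using c by (simp add: T_def)
      moreover have "x + ?c / 2 * (t - 1) - rm - (?c / 8 * (t + 1) + 2 * S\<^sup>2 / ?c) - ?c / 4 * t =
          ?c / 8 * t - (rm + 5 / 8 * ?c + 2 * S\<^sup>2 / ?c - x)"
        by (simp add: algebra_simps add_divide_distrib diff_divide_distrib)
      ultimately show ?thesis by linarith
    qed
    then show ?case
      unfolding eventually_at_top_linorder by (intro exI[of _ "max 1 (max (real N + 1) T)"]) auto
  qed
qed

end

theorem theorem1:
  fixes M :: "'a measure"
    and W :: "real \<Rightarrow> 'a \<Rightarrow> real"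
    and Z :: "real \<Rightarrow> 'a \<Rightarrow> nat"
    and X :: "real \<Rightarrow> 'a \<Rightarrow> real"
    and bp bm :: "real \<Rightarrow> real"
    and lp lm rp rm x :: real
    and z :: nat
  assumes "prob_space M"
    and "lp > 0" and "lm > 0"
    and "z \<in> {0, 1}"
    and "wiener_process M W"
    and "two_state_chain M lp lm z Z"
    and "indep_processes M W Z"
    and "bp \<in> borel_measurable borel" and "bm \<in> borel_measurable borel"
    and "\<exists>B. \<forall>y. \<bar>bp y\<bar> \<le> B \<and> \<bar>bm y\<bar> \<le> B"
    and "strong_solution M bp bm x W Z X"
    and "rp > 0" and "rm > 0"
    and "\<forall>y. bp y \<ge> rp" and "\<forall>y. bm y \<ge> - rm"
    and "rp / lp > rm / lm"
  shows "(AE \<omega> in M. filterlim (\<lambda>t. X t \<omega>) at_top at_top)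
       \<and> (\<exists>c0>0. AE \<omega> in M. Liminf at_top (\<lambda>t. ereal (X t \<omega> / t)) \<ge> ereal c0)
       \<and> (\<exists>c0>0. \<forall>\<epsilon>>0. \<exists>\<kappa>. 0 < \<kappa> \<and> \<kappa> < 1 \<and> (\<exists>t0. \<forall>t\<ge>t0.
            measure M {\<omega> \<in> space M. (X t \<omega> - x) / t - c0 < - \<epsilon>} < \<kappa> powr t))"
proof -
  interpret prob_space M by fact
  interpret switched_diffusion M W X Z bp bm lp lm rp rm x z
    by unfold_locales (use assms in auto)
  let ?c = mean_drift
  \<comment> \<open>The two constants of the claim are chosen separately: \<open>?c / 4\<close> for
    the lower limit and \<open>?c\<close> itself for the tail bound.\<close>
  have c: "?c / 4 > 0" using mean_drift_pos by simp
  have "AE \<omega> in M. filterlim (\<lambda>t. X t \<omega>) at_top at_top"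
    using AE_eventually_linear_growth
  proof eventually_elim
    case (elim \<omega>)
    have "filterlim (\<lambda>t. ?c / 4 * t) at_top at_top"
      using c by (intro filterlim_tendsto_pos_mult_at_top[OF tendsto_const]) (auto intro: filterlim_ident)
    then show ?case using elim by (rule filterlim_at_top_mono)
  qed
  moreover have "AE \<omega> in M. Liminf at_top (\<lambda>t. ereal (X t \<omega> / t)) \<ge> ereal (?c / 4)"
    using AE_eventually_linear_growth
  proof eventually_elim
    case (elim \<omega>)
    then have "eventually (\<lambda>t. ereal (?c / 4) \<le> ereal (X t \<omega> / t)) at_top"
      using eventually_gt_at_top[of 0] by eventually_elim (simp add: pos_le_divide_eq)
    then show ?case by (rule Liminf_bounded)
  qed
  moreover have "\<forall>\<epsilon>>0. \<exists>\<kappa>. 0 < \<kappa> \<and> \<kappa> < 1 \<and> (\<exists>t0. \<forall>t\<ge>t0.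
      prob {\<omega> \<in> space M. (X t \<omega> - x) / t - ?c < - \<epsilon>} < \<kappa> powr t)"
    using lower_tail_exponentially_small by blast
  ultimately show ?thesis using c mean_drift_pos by blast
qed

end
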